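(* Let $A$ be an algebra in a congruence-modular variety, let $\alpha\in\operatorname{Con}A$ and let $\mathcal U\in\operatorname{Unif}A$. Then $[\alpha,\mathcal U]\le[\alpha,\mathcal U]'$, with equality if $A$ has an underlying group structure.
   Context: Algebras have finitary operations (the underlying set may be empty). A uniformity on a set $S$ is a filter $\mathcal U$ of binary relations on $S$ such that every $U\in\mathcal U$ is reflexive, $U\in\mathcal U$ implies $U^{-1}\in\mathcal U$, and for each $U\in\mathcal U$ there is $V\in\mathcal U$ with $V\circ V\subseteq U$. A uniformity $\mathcal U$ on an algebra $A$ is compatible if for each basic operation $\omega$ and $U\in\mathcal U$ there is $\bar U\in\mathcal U$ such that $x_i\mathrel{\bar U}y_i$ for all $i$ implies $\omega(\mathbf x)\mathrel U\omega(\mathbf y)$. $\operatorname{Unif}A$ is the complete lattice of compatible uniformities on $A$, ordered by reverse inclusion ($\mathcal U\le\mathcal V$ iff $\mathcal V\subseteq\mathcal U$). A congruence $\theta$ is identified, where a uniformity is required, with $\operatorname{Ug}\{\theta\}=\{U:\theta\subseteq U\}$. For a homomorphism $f:B\to A$ and a filter $\mathcal U$ of relations on $A$, $f^{-1}(\mathcal U)$ is the filter generated by the relations $f^{-1}(U)=\{\langle b,b'\rangle: f(b)\mathrel Uf(b')\}$, $U\in\mathcal U$. For $f:A\to B$ and $\mathcal U\in\operatorname{Unif}A$, $f_{*c}(\mathcal U)$ is the meet of all $\mathcal V\in\operatorname{Unif}B$ with $\mathcal U\le f^{-1}(\mathcal V)$. For binary relations $U,V$ on $A$, $n,n'\ge0$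 and an $(n+n')$-ary term $t$, $\mathrm M_{n,n',t}(U,V)$ is the set of matrices $\begin{pmatrix}t(\mathbf a,\mathbf b)&t(\mathbf a,\mathbf c)\\t(\mathbf a',\mathbf b)&t(\mathbf a',\mathbf c)\end{pmatrix}$ with $\mathbf a,\mathbf a'\in A^n$, $\mathbf b,\mathbf c\in A^{n'}$, $a_i\mathrel Ua'_i$ and $b_j\mathrel Vc_j$ for all $i,j$. For $A$ in a congruence-modular variety, the commutator $[\mathcal U,\mathcal V]$ of $\mathcal U,\mathcal V\in\operatorname{Unif}A$ is the least $\mathcal W\in\operatorname{Unif}A$ such that for all $n,n',t$ and all $W\in\mathcal W$ there are $U\in\mathcal U$, $V\in\mathcal V$, $\bar W\in\mathcal W$ such that $(u_{ij})\in\mathrm M_{n,n',t}(U,V)$ and $u_{11}\mathrel{\bar W}u_{12}$ imply $u_{21}\mathrel Wu_{22}$. $[\alpha,\mathcal U]$ denotes $[\operatorname{Ug}\{\alpha\},\mathcal U]$. $A(\alpha)$ is the subalgebra $\{\langle a,b\rangle:a\mathrel\alpha b\}$ of $A^2$; $\pi,\pi':A(\alpha)\to A$ are the first and second projections; $\Delta_\alpha:A\to A(\alpha)$ is $a\mapsto\langle a,a\rangle$; and $\Delta_{\alpha,\mathcal U}=(\Delta_\alpha)_{*c}(\mathcal U)\in\operatorname{Unif}A(\alpha)$. $[\alpha,\mathcal U]'$ is the unique compatible uniformity on $A$ such that $(\pi')^{-1}([\alpha,\mathcal U]')=(\Delta_{\alpha,\mathcal U}\wedge\ker\pi)\vee\ker\pi'$,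 with lattice operations in $\operatorname{Unif}A(\alpha)$. "$A$ has an underlying group structure" means that $A$ has term operations (multiplication, inverse, identity) that make its underlying set a group. *)

theory Defs
  imports "HOL-Algebra.Group"
begin

section \<open>Terms and algebras\<close>

text \<open>A signature maps its operation symbols to their arities; names outside its domain are not
  operation symbols, so that a signature may be empty.\<close>

type_synonym 'f signature = "'f \<rightharpoonup> nat"

datatype ('f, vars: 'v) trm = Var 'v | App 'f "('f, 'v) trm list"

primrec wf_trm :: "'f signature \<Rightarrow> ('f, 'v) trm \<Rightarrow> bool" where
  "wf_trm \<Omega> (Var v) \<longleftrightarrow> True"
| "wf_trm \<Omega> (App f ts) \<longleftrightarrow> \<Omega> f = Some (length ts) \<and> list_all (wf_trm \<Omega>) ts"

record ('f, 'a) alg = "'a partial_object" +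
  interp :: "'f \<Rightarrow> 'a list \<Rightarrow> 'a"

definition is_algebra :: "'f signature \<Rightarrow> ('f, 'a) alg \<Rightarrow> bool" where
  "is_algebra \<Omega> A \<longleftrightarrow> (\<forall>f n xs. \<Omega> f = Some n \<longrightarrow> length xs = n \<longrightarrow> set xs \<subseteq> carrier A
     \<longrightarrow> interp A f xs \<in> carrier A)"

primrec eval :: "('f, 'a) alg \<Rightarrow> ('v \<Rightarrow> 'a) \<Rightarrow> ('f, 'v) trm \<Rightarrow> 'a" where
  "eval A \<rho> (Var v) = \<rho> v"
| "eval A \<rho> (App f ts) = interp A f (map (eval A \<rho>) ts)"

definition nary_term :: "'f signature \<Rightarrow> nat \<Rightarrow> ('f, nat) trm \<Rightarrow> bool" where
  "nary_term \<Omega> n t \<longleftrightarrow> wf_trm \<Omega> t \<and> vars t \<subseteq> {..<n}"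

definition term_op :: "('f, 'a) alg \<Rightarrow> ('f, nat) trm \<Rightarrow> 'a list \<Rightarrow> 'a" where
  "term_op A t xs = eval A (\<lambda>i. xs ! i) t"

definition has_group_structure :: "'f signature \<Rightarrow> ('f, 'a) alg \<Rightarrow> bool" where
  "has_group_structure \<Omega> A \<longleftrightarrow> (\<exists>m i e. nary_term \<Omega> 2 m \<and> nary_term \<Omega> 1 i \<and> nary_term \<Omega> 0 e \<and>
     (let G = \<lparr>carrier = carrier A, mult = (\<lambda>x y. term_op A m [x, y]), one = term_op A e []\<rparr>
      in group G \<and> (\<forall>x\<in>carrier A. term_op A i [x] = inv\<^bsub>G\<^esub> x)))"

section \<open>Congruences and congruence-modular varieties\<close>

definition is_congruence :: "'f signature \<Rightarrow> ('f, 'a) alg \<Rightarrow> ('a \<times> 'a) set \<Rightarrow> bool" where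
  "is_congruence \<Omega> A \<theta> \<longleftrightarrow> equiv (carrier A) \<theta> \<and>
     (\<forall>f n xs ys. \<Omega> f = Some n \<longrightarrow> length xs = n \<longrightarrow> list_all2 (\<lambda>x y. (x, y) \<in> \<theta>) xs ys
        \<longrightarrow> (interp A f xs, interp A f ys) \<in> \<theta>)"

definition Con :: "'f signature \<Rightarrow> ('f, 'a) alg \<Rightarrow> ('a \<times> 'a) set gorder" where
  "Con \<Omega> A = \<lparr>carrier = {\<theta>. is_congruence \<Omega> A \<theta>}, eq = (=), le = (\<subseteq>)\<rparr>"

definition modular_lattice :: "('b, 'c) gorder_scheme \<Rightarrow> bool" where
  "modular_lattice L \<longleftrightarrow> lattice L \<and>
     (\<forall>x\<in>carrier L. \<forall>y\<in>carrier L. \<forall>z\<in>carrier L.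
        x \<sqsubseteq>\<^bsub>L\<^esub> z \<longrightarrow> (x \<squnion>\<^bsub>L\<^esub> y) \<sqinter>\<^bsub>L\<^esub> z = x \<squnion>\<^bsub>L\<^esub> (y \<sqinter>\<^bsub>L\<^esub> z))"

text \<open>Varieties are given as equational classes: a set of pairs of terms over countably many
  variables is read as a set of identities. The variables range over the carrier, so an algebra
  with empty carrier satisfies every identity.\<close>

definition models :: "('f, 'a) alg \<Rightarrow> (('f, nat) trm \<times> ('f, nat) trm) set \<Rightarrow> bool" where
  "models A E \<longleftrightarrow> (\<forall>(s, t)\<in>E. \<forall>\<rho>. range \<rho> \<subseteq> carrier A \<longrightarrow> eval A \<rho> s = eval A \<rho> t)"

text \<open>A HOL formula cannot quantify over the algebras on all types, so the definition ranges over
  the members of the variety whose carrier is a set of terms. This is no restriction: the lemma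
  \<open>cm_varietyD\<close> below shows that then the members on every type have modular congruence lattices.\<close>

definition cm_variety :: "'f signature \<Rightarrow> (('f, nat) trm \<times> ('f, nat) trm) set \<Rightarrow> bool" where
  "cm_variety \<Omega> E \<longleftrightarrow> (\<forall>(s, t)\<in>E. wf_trm \<Omega> s \<and> wf_trm \<Omega> t) \<and>
     (\<forall>B :: ('f, ('f, nat) trm) alg. is_algebra \<Omega> B \<and> models B E \<longrightarrow> modular_lattice (Con \<Omega> B))"

lemma eval_carrier:
  assumes "is_algebra \<Omega> A" "range \<rho> \<subseteq> carrier A" "wf_trm \<Omega> t"
  shows "eval A \<rho> t \<in> carrier A"
  using assms(3)
proof (induction t)
  case (Var v)
  then show ?case using assms(2) by auto
next
  case (App f ts)
  then have "set (map (eval A \<rho>) ts) \<subseteq> carrier A" by (auto simp: list_all_iff)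
  then show ?case using App.prems assms(1) unfolding is_algebra_def by simp
qed

lemma Con_simps [simp]:
  "\<theta> \<in> carrier (Con \<Omega> A) \<longleftrightarrow> is_congruence \<Omega> A \<theta>"
  "\<theta> \<sqsubseteq>\<^bsub>Con \<Omega> A\<^esub> \<phi> \<longleftrightarrow> \<theta> \<subseteq> \<phi>"
  "\<theta> .=\<^bsub>Con \<Omega> A\<^esub> \<phi> \<longleftrightarrow> \<theta> = \<phi>"
  by (simp_all add: Con_def)

lemma partial_order_Con: "partial_order (Con \<Omega> A)"
  by unfold_locales (auto simp: Con_def)

lemma is_congruence_Int:
  assumes "is_congruence \<Omega> A \<theta>" "is_congruence \<Omega> A \<phi>"
  shows "is_congruence \<Omega> A (\<theta> \<inter> \<phi>)"
proof -
  have "equiv (carrier A) (\<theta> \<inter> \<phi>)"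
    using assms by (auto simp: is_congruence_def equiv_def refl_on_def intro: sym_Int trans_Int)
  moreover have "list_all2 (\<lambda>x y. (x, y) \<in> \<theta>) xs ys \<and> list_all2 (\<lambda>x y. (x, y) \<in> \<phi>) xs ys"
    if "list_all2 (\<lambda>x y. (x, y) \<in> \<theta> \<inter> \<phi>) xs ys" for xs ys
    using that by (auto elim: list_all2_mono)
  ultimately show ?thesis using assms unfolding is_congruence_def by blast
qed

lemma trancl_list_all2:
  assumes refl: "\<And>x. x \<in> S \<Longrightarrow> (x, x) \<in> r" and r: "r \<subseteq> S \<times> S"
    and step: "\<And>us x y vs. (x, y) \<in> r \<Longrightarrow> set us \<subseteq> S \<Longrightarrow> set vs \<subseteq> S
      \<Longrightarrow> length us + length vs + 1 = n \<Longrightarrow> (F (us @ x # vs), F (us @ y # vs)) \<in> r"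
    and base: "\<And>us. length us = n \<Longrightarrow> set us \<subseteq> S \<Longrightarrow> F us \<in> S"
    and "list_all2 (\<lambda>x y. (x, y) \<in> r\<^sup>+) xs ys" "length us + length xs = n" "set us \<subseteq> S"
  shows "(F (us @ xs), F (us @ ys)) \<in> r\<^sup>+"
  using assms(5-)
proof (induction xs ys arbitrary: us rule: list_all2_induct)
  case Nil
  then show ?case using refl base by auto
next
  case (Cons x xs y ys)
  have rS: "r\<^sup>+ \<subseteq> S \<times> S" using r by (rule trancl_subset_Sigma)
  have S: "x \<in> S" "y \<in> S" using Cons.hyps(1) rS by auto
  have xs: "set xs \<subseteq> S"
    using Cons.hyps(2) rS by (fastforce simp: list_all2_conv_all_nth in_set_conv_nth)
  have "(F (us @ x # xs), F (us @ y # xs)) \<in> r\<^sup>+"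
    using Cons.hyps(1)
  proof (induction rule: trancl_induct)
    case (base y)
    then show ?case using step[of x y us xs] Cons.prems xs by auto
  next
    case (step y z)
    then show ?case using assms(3)[of y z us xs] Cons.prems xs
      by (auto intro: trancl_into_trancl)
  qed
  moreover have "(F ((us @ [y]) @ xs), F ((us @ [y]) @ ys)) \<in> r\<^sup>+"
    using Cons.IH[of "us @ [y]"] Cons.prems S by auto
  ultimately show ?case by (auto intro: trancl_trans)
qed

lemma list_all2_refl_equiv:
  assumes "equiv S \<theta>" "set us \<subseteq> S"
  shows "list_all2 (\<lambda>x y. (x, y) \<in> \<theta>) us us"
  using assms by (auto simp: list_all2_same equiv_def refl_on_def)

lemma is_congruence_join:
  assumes A: "is_algebra \<Omega> A" and \<theta>: "is_congruence \<Omega> A \<theta>" and \<phi>: "is_congruence \<Omega> A \<phi>"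
  shows "is_congruence \<Omega> A ((\<theta> \<union> \<phi>)\<^sup>+)"
proof -
  let ?r = "\<theta> \<union> \<phi>"
  have e: "equiv (carrier A) \<theta>" "equiv (carrier A) \<phi>"
    using \<theta> \<phi> by (auto simp: is_congruence_def)
  have r: "?r \<subseteq> carrier A \<times> carrier A" using e by (auto simp: equiv_def)
  have rf: "(x, x) \<in> ?r" if "x \<in> carrier A" for x
    using e that by (auto simp: equiv_def refl_on_def)
  have "equiv (carrier A) (?r\<^sup>+)"
  proof (rule equivI)
    show "?r\<^sup>+ \<subseteq> carrier A \<times> carrier A" using r by (rule trancl_subset_Sigma)
    show "refl_on (carrier A) (?r\<^sup>+)" using rf by (auto simp: refl_on_def)
    show "sym (?r\<^sup>+)" using e by (auto intro: sym_trancl simp: equiv_def sym_Un)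
    show "trans (?r\<^sup>+)" by (rule trans_trancl)
  qed
  moreover have "(interp A f xs, interp A f ys) \<in> ?r\<^sup>+"
    if f: "\<Omega> f = Some n" "length xs = n" "list_all2 (\<lambda>x y. (x, y) \<in> ?r\<^sup>+) xs ys" for f n xs ys
  proof -
    have "(interp A f ([] @ xs), interp A f ([] @ ys)) \<in> ?r\<^sup>+"
    proof (rule trancl_list_all2[where S = "carrier A" and n = n])
      fix us x y vs
      assume h: "(x, y) \<in> ?r" "set us \<subseteq> carrier A" "set vs \<subseteq> carrier A"
        "length us + length vs + 1 = n"
      have *: "(interp A f (us @ x # vs), interp A f (us @ y # vs)) \<in> \<psi>"
        if "(x, y) \<in> \<psi>" "is_congruence \<Omega> A \<psi>" for \<psi>
      proof -
        have "equiv (carrier A) \<psi>" using that by (simp add: is_congruence_def)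
        then have "list_all2 (\<lambda>x y. (x, y) \<in> \<psi>) (us @ x # vs) (us @ y # vs)"
          using h that by (auto intro!: list_all2_appendI list_all2_refl_equiv)
        then show ?thesis using that h f unfolding is_congruence_def by simp
      qed
      show "(interp A f (us @ x # vs), interp A f (us @ y # vs)) \<in> ?r"
        using h(1) * \<theta> \<phi> by blast
    qed (use r rf f A in \<open>auto simp: is_algebra_def\<close>)
    then show ?thesis by simp
  qed
  ultimately show ?thesis unfolding is_congruence_def by blast
qed

lemma greatest_Con:
  assumes "is_congruence \<Omega> A \<theta>" "is_congruence \<Omega> A \<phi>"
  shows "greatest (Con \<Omega> A) (\<theta> \<inter> \<phi>) (Lower (Con \<Omega> A) {\<theta>, \<phi>})"
  using assms is_congruence_Int[OF assms] by (auto simp: greatest_def Lower_def)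

lemma least_Con:
  assumes "is_algebra \<Omega> A" "is_congruence \<Omega> A \<theta>" "is_congruence \<Omega> A \<phi>"
  shows "least (Con \<Omega> A) ((\<theta> \<union> \<phi>)\<^sup>+) (Upper (Con \<Omega> A) {\<theta>, \<phi>})"
proof -
  have "(\<theta> \<union> \<phi>)\<^sup>+ \<subseteq> \<psi>" if "is_congruence \<Omega> A \<psi>" "\<theta> \<subseteq> \<psi>" "\<phi> \<subseteq> \<psi>" for \<psi>
  proof -
    have "trans \<psi>" using that by (simp add: is_congruence_def equiv_def)
    then have "\<psi>\<^sup>+ = \<psi>" by (rule trancl_id)
    then show ?thesis using trancl_mono_subset[of "\<theta> \<union> \<phi>" \<psi>] that by auto
  qed
  then show ?thesis
    using assms is_congruence_join[OF assms] by (auto simp: least_def Upper_def)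
qed

lemma lattice_Con: "is_algebra \<Omega> A \<Longrightarrow> lattice (Con \<Omega> A)"
proof -
  assume A: "is_algebra \<Omega> A"
  interpret partial_order "Con \<Omega> A" by (rule partial_order_Con)
  show ?thesis
  proof unfold_locales
    fix \<theta> \<phi> assume "\<theta> \<in> carrier (Con \<Omega> A)" "\<phi> \<in> carrier (Con \<Omega> A)"
    then have c: "is_congruence \<Omega> A \<theta>" "is_congruence \<Omega> A \<phi>" by simp_all
    show "\<exists>s. least (Con \<Omega> A) s (Upper (Con \<Omega> A) {\<theta>, \<phi>})"
      using least_Con[OF A c] by (rule exI)
    show "\<exists>s. greatest (Con \<Omega> A) s (Lower (Con \<Omega> A) {\<theta>, \<phi>})"
      using greatest_Con[OF c] by (rule exI)
  qed
qed

lemma meet_Con: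
  assumes "is_congruence \<Omega> A \<theta>" "is_congruence \<Omega> A \<phi>"
  shows "\<theta> \<sqinter>\<^bsub>Con \<Omega> A\<^esub> \<phi> = \<theta> \<inter> \<phi>"
proof -
  have "\<psi> = \<theta> \<inter> \<phi>" if "greatest (Con \<Omega> A) \<psi> (Lower (Con \<Omega> A) {\<theta>, \<phi>})" for \<psi>
    using that greatest_Con[OF assms] unfolding greatest_def by (metis Con_simps(2) subset_antisym)
  then show ?thesis
    unfolding meet_def inf_def using greatest_Con[OF assms] by (rule some_equality[rotated])
qed

lemma join_Con:
  assumes "is_algebra \<Omega> A" "is_congruence \<Omega> A \<theta>" "is_congruence \<Omega> A \<phi>"
  shows "\<theta> \<squnion>\<^bsub>Con \<Omega> A\<^esub> \<phi> = (\<theta> \<union> \<phi>)\<^sup>+"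
proof -
  have "\<psi> = (\<theta> \<union> \<phi>)\<^sup>+" if "least (Con \<Omega> A) \<psi> (Upper (Con \<Omega> A) {\<theta>, \<phi>})" for \<psi>
    using that least_Con[OF assms] unfolding least_def by (metis Con_simps(2) subset_antisym)
  then show ?thesis
    unfolding join_def sup_def using least_Con[OF assms] by (rule some_equality[rotated])
qed

lemma cm_varietyD:
  fixes B :: "('f, 'b) alg"
  assumes E: "cm_variety \<Omega> E" and B: "is_algebra \<Omega> B" "models B E"
  shows "modular_lattice (Con \<Omega> B)"
proof -
  have key: "(a, b) \<in> (x \<union> y \<inter> z)\<^sup>+"
    if x: "is_congruence \<Omega> B x" and y: "is_congruence \<Omega> B y" and z: "is_congruence \<Omega> B z"
      and xz: "x \<subseteq> z" and ab: "(a, b) \<in> (x \<union> y)\<^sup>+" "(a, b) \<in> z" for x y z a b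
  proof -
    obtain n where "(a, b) \<in> (x \<union> y) ^^ n" using ab(1) trancl_power by blast
    then obtain p where p: "p 0 = a" "p n = b" "\<And>i. i < n \<Longrightarrow> (p i, p (Suc i)) \<in> x \<union> y"
      unfolding relpow_fun_conv by blast
    have sub: "x \<subseteq> carrier B \<times> carrier B" "y \<subseteq> carrier B \<times> carrier B" "z \<subseteq> carrier B \<times> carrier B"
      using x y z by (auto simp: is_congruence_def equiv_def)
    have aB: "a \<in> carrier B" "b \<in> carrier B" using ab(2) sub by auto
    define \<rho> where "\<rho> i = (if i \<le> n then p i else a)" for i
    have \<rho>: "range \<rho> \<subseteq> carrier B"
    proof -
      have "p i \<in> carrier B" if "i \<le> n" for i
        using that p(2) p(3)[of i] sub aB by (cases "i = n") auto
      then show ?thesis using aB by (auto simp: \<rho>_def)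
    qed
    define h where "h = (eval B \<rho> :: ('f, nat) trm \<Rightarrow> 'b)"
    define S where "S = h ` {t. wf_trm \<Omega> t}"
    define g where "g c = (SOME t. wf_trm \<Omega> t \<and> h t = c)" for c
    have g: "wf_trm \<Omega> (g c)" "h (g c) = c" if "c \<in> S" for c
      using that someI_ex[of "\<lambda>t. wf_trm \<Omega> t \<and> h t = c"] unfolding g_def S_def by auto
    have SB: "S \<subseteq> carrier B"
      using eval_carrier[OF B(1) \<rho>] by (auto simp: S_def h_def)
    have \<rho>S: "\<rho> i \<in> S" for i
      unfolding S_def by (rule image_eqI[of _ _ "Var i"]) (auto simp: h_def)
    have S_interp: "interp B f xs \<in> S" if "\<Omega> f = Some (length xs)" "set xs \<subseteq> S" for f xs
    proof -
      have "map (h \<circ> g) xs = xs" using g that by (auto intro!: map_idI)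
      then have "interp B f xs = h (App f (map g xs))" by (simp add: h_def o_def)
      moreover have "wf_trm \<Omega> (App f (map g xs))"
        using that g by (auto simp: list_all_iff)
      ultimately show ?thesis by (auto simp: S_def)
    qed
    define C where "C = \<lparr>carrier = g ` S, interp = (\<lambda>f ts. g (interp B f (map h ts)))\<rparr>"
    have hC: "h t \<in> S" "g (h t) = t" if "t \<in> carrier C" for t
      using that g by (auto simp: C_def)
    have hC_interp: "h (interp C f us) = interp B f (map h us)"
      if "interp B f (map h us) \<in> S" for f us
      using that g by (simp add: C_def)
    have C: "is_algebra \<Omega> C"
      unfolding is_algebra_def
    proof (intro allI impI)
      fix f n ts assume "\<Omega> f = Some n" "length ts = n" "set ts \<subseteq> carrier C"
      then have "interp B f (map h ts) \<in> S" by (intro S_interp) (use hC in auto)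
      then show "interp C f ts \<in> carrier C" by (simp add: C_def)
    qed
    have evC: "h (eval C \<sigma> t) = eval B (\<lambda>i. h (\<sigma> i)) t"
      if "range \<sigma> \<subseteq> carrier C" "wf_trm \<Omega> t" for \<sigma> and t :: "('f, nat) trm"
      using that(2)
    proof (induction t)
      case (Var v)
      then show ?case by simp
    next
      case (App f ts)
      then have IH: "map (h \<circ> eval C \<sigma>) ts = map (eval B (\<lambda>i. h (\<sigma> i))) ts"
        by (auto simp: list_all_iff)
      have "set (map (h \<circ> eval C \<sigma>) ts) \<subseteq> S"
        using App.prems hC(1) eval_carrier[OF C that(1)] by (auto simp: list_all_iff)
      then have "interp B f (map (h \<circ> eval C \<sigma>) ts) \<in> S"
        by (intro S_interp) (use App.prems in auto)
      then have "h (eval C \<sigma> (App f ts)) = interp B f (map (h \<circ> eval C \<sigma>) ts)"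
        by (simp add: hC_interp)
      also have "\<dots> = eval B (\<lambda>i. h (\<sigma> i)) (App f ts)" by (simp only: IH eval.simps)
      finally show ?case .
    qed
    have CE: "models C E"
      unfolding models_def
    proof clarify
      fix s t and \<sigma> :: "nat \<Rightarrow> ('f, nat) trm"
      assume st: "(s, t) \<in> E" and \<sigma>: "range \<sigma> \<subseteq> carrier C"
      have wf: "wf_trm \<Omega> s" "wf_trm \<Omega> t" using E st by (auto simp: cm_variety_def)
      have "range (\<lambda>i. h (\<sigma> i)) \<subseteq> carrier B" using \<sigma> hC SB by fastforce
      then have "eval B (\<lambda>i. h (\<sigma> i)) s = eval B (\<lambda>i. h (\<sigma> i)) t" using B(2) st by (auto simp: models_def)
      then have "h (eval C \<sigma> s) = h (eval C \<sigma> t)" using evC \<sigma> wf by simp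
      then show "eval C \<sigma> s = eval C \<sigma> t"
        using hC(2) eval_carrier[OF C \<sigma>] wf by metis
    qed
    define P where "P w = {(s, t). s \<in> carrier C \<and> t \<in> carrier C \<and> (h s, h t) \<in> w}" for w
    have P: "is_congruence \<Omega> C (P w)" if w: "is_congruence \<Omega> B w" for w
      unfolding is_congruence_def
    proof (intro conjI allI impI)
      have "equiv (carrier B) w" using w by (simp add: is_congruence_def)
      then show "equiv (carrier C) (P w)"
        using hC(1) SB unfolding equiv_def refl_on_def sym_def trans_def P_def by blast
      fix f n ss ts
      assume f: "\<Omega> f = Some n" "length ss = n" "list_all2 (\<lambda>s t. (s, t) \<in> P w) ss ts"
      have len: "length ts = n" using f list_all2_lengthD by fastforce
      have ST: "set ss \<subseteq> carrier C" "set ts \<subseteq> carrier C"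
        using f(3) by (auto simp: P_def list_all2_conv_all_nth in_set_conv_nth)
      have "list_all2 (\<lambda>x y. (x, y) \<in> w) (map h ss) (map h ts)"
        using f(3) by (auto simp: P_def list_all2_conv_all_nth)
      then have "(interp B f (map h ss), interp B f (map h ts)) \<in> w"
        using w f unfolding is_congruence_def by auto
      moreover have "interp B f (map h ss) \<in> S" "interp B f (map h ts) \<in> S"
        by (intro S_interp; use f len ST hC in auto)+
      ultimately show "(interp C f ss, interp C f ts) \<in> P w"
        using g by (auto simp: P_def C_def)
    qed
    have "modular_lattice (Con \<Omega> C)" using E C CE unfolding cm_variety_def by blast
    moreover have "P x \<subseteq> P z" using xz by (auto simp: P_def)
    ultimately have "(P x \<squnion>\<^bsub>Con \<Omega> C\<^esub> P y) \<sqinter>\<^bsub>Con \<Omega> C\<^esub> P z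
        = P x \<squnion>\<^bsub>Con \<Omega> C\<^esub> (P y \<sqinter>\<^bsub>Con \<Omega> C\<^esub> P z)"
      using P x y z unfolding modular_lattice_def by simp
    then have mod: "(P x \<union> P y)\<^sup>+ \<inter> P z = (P x \<union> P y \<inter> P z)\<^sup>+"
      using P x y z C by (simp add: join_Con meet_Con is_congruence_join is_congruence_Int)
    have gS: "g c \<in> carrier C" if "c \<in> S" for c using that by (simp add: C_def)
    have "(g (\<rho> 0), g (\<rho> n)) \<in> (P x \<union> P y) ^^ n"
      unfolding relpow_fun_conv
    proof (intro exI[of _ "g \<circ> \<rho>"] conjI allI impI)
      fix i assume i: "i < n"
      then have "(\<rho> i, \<rho> (Suc i)) \<in> x \<union> y" using p(3) by (simp add: \<rho>_def)
      then show "((g \<circ> \<rho>) i, (g \<circ> \<rho>) (Suc i)) \<in> P x \<union> P y"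
        using gS \<rho>S g(2) by (auto simp: P_def)
    qed auto
    moreover have \<rho>0: "\<rho> 0 = a" "\<rho> n = b" using p by (auto simp: \<rho>_def)
    moreover have abS: "a \<in> S" "b \<in> S" using \<rho>S \<rho>0 by metis+
    moreover have "(g a, g a) \<in> P x"
      using gS abS g(2) x aB by (auto simp: P_def is_congruence_def equiv_def refl_on_def)
    ultimately have "(g a, g b) \<in> (P x \<union> P y)\<^sup>+"
      by (metis UnI1 relpow_imp_rtrancl rtrancl_eq_or_trancl trancl.r_into_trancl)
    moreover have "(g a, g b) \<in> P z" using gS abS g(2) ab(2) by (auto simp: P_def)
    ultimately have "(g a, g b) \<in> (P x \<union> P y \<inter> P z)\<^sup>+" using mod by blast
    then have "(h (g a), h (g b)) \<in> (x \<union> y \<inter> z)\<^sup>+"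
    proof (induction rule: trancl_induct)
      case (base t)
      then show ?case by (auto simp: P_def)
    next
      case (step s t)
      then have "(h s, h t) \<in> x \<union> y \<inter> z" by (auto simp: P_def)
      then show ?case using step.IH by (rule trancl_into_trancl[rotated])
    qed
    then show ?thesis using g(2) abS by simp
  qed
  have "(x \<union> y)\<^sup>+ \<inter> z = (x \<union> y \<inter> z)\<^sup>+"
    if "is_congruence \<Omega> B x" "is_congruence \<Omega> B y" "is_congruence \<Omega> B z" "x \<subseteq> z" for x y z
  proof
    show "(x \<union> y)\<^sup>+ \<inter> z \<subseteq> (x \<union> y \<inter> z)\<^sup>+" using key[OF that] by auto
    have "(x \<union> y \<inter> z)\<^sup>+ \<subseteq> z\<^sup>+" by (rule trancl_mono_subset) (use that in auto)
    moreover have "z\<^sup>+ = z" using that by (simp add: is_congruence_def equiv_def trancl_id)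
    moreover have "(x \<union> y \<inter> z)\<^sup>+ \<subseteq> (x \<union> y)\<^sup>+" by (rule trancl_mono_subset) auto
    ultimately show "(x \<union> y \<inter> z)\<^sup>+ \<subseteq> (x \<union> y)\<^sup>+ \<inter> z" by blast
  qed
  then show ?thesis
    unfolding modular_lattice_def using lattice_Con B(1)
    by (auto simp: join_Con meet_Con is_congruence_join is_congruence_Int)
qed

section \<open>Compatible uniformities\<close>

definition is_filter_on :: "'s set \<Rightarrow> ('s \<times> 's) set set \<Rightarrow> bool" where
  "is_filter_on S \<U> \<longleftrightarrow> \<U> \<subseteq> Pow (S \<times> S) \<and> S \<times> S \<in> \<U> \<and> (\<forall>U\<in>\<U>. \<forall>V\<in>\<U>. U \<inter> V \<in> \<U>) \<and>
     (\<forall>U\<in>\<U>. \<forall>V. U \<subseteq> V \<and> V \<subseteq> S \<times> S \<longrightarrow> V \<in> \<U>)"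

text \<open>The least filter containing a set of relations; since \<open>S \<times> S\<close> is included in the intersection,
  the empty set generates \<open>{S \<times> S}\<close>.\<close>

definition gen_filter :: "'s set \<Rightarrow> ('s \<times> 's) set set \<Rightarrow> ('s \<times> 's) set set" where
  "gen_filter S \<G> = {U. U \<subseteq> S \<times> S \<and> (\<exists>\<F>. finite \<F> \<and> \<F> \<subseteq> \<G> \<and> (S \<times> S) \<inter> \<Inter>\<F> \<subseteq> U)}"

definition is_uniformity :: "'s set \<Rightarrow> ('s \<times> 's) set set \<Rightarrow> bool" where
  "is_uniformity S \<U> \<longleftrightarrow> is_filter_on S \<U> \<and>
     (\<forall>U\<in>\<U>. refl_on S U \<and> U\<inverse> \<in> \<U> \<and> (\<exists>V\<in>\<U>. V O V \<subseteq> U))"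

definition is_compatible :: "'f signature \<Rightarrow> ('f, 'a) alg \<Rightarrow> ('a \<times> 'a) set set \<Rightarrow> bool" where
  "is_compatible \<Omega> A \<U> \<longleftrightarrow> (\<forall>f n. \<Omega> f = Some n \<longrightarrow> (\<forall>U\<in>\<U>. \<exists>U'\<in>\<U>. \<forall>xs ys. length xs = n \<longrightarrow>
     list_all2 (\<lambda>x y. (x, y) \<in> U') xs ys \<longrightarrow> (interp A f xs, interp A f ys) \<in> U))"

text \<open>The order is reverse inclusion: finer uniformities are smaller.\<close>

definition Unif :: "'f signature \<Rightarrow> ('f, 'a) alg \<Rightarrow> ('a \<times> 'a) set set gorder" where
  "Unif \<Omega> A = \<lparr>carrier = {\<U>. is_uniformity (carrier A) \<U> \<and> is_compatible \<Omega> A \<U>},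
     eq = (=), le = (\<lambda>\<U> \<V>. \<V> \<subseteq> \<U>)\<rparr>"

definition Ug :: "('f, 'a) alg \<Rightarrow> ('a \<times> 'a) set \<Rightarrow> ('a \<times> 'a) set set" where
  "Ug A \<theta> = {U. U \<subseteq> carrier A \<times> carrier A \<and> \<theta> \<subseteq> U}"

definition inv_filter ::
    "('f, 'b) alg \<Rightarrow> ('b \<Rightarrow> 'a) \<Rightarrow> ('a \<times> 'a) set set \<Rightarrow> ('b \<times> 'b) set set" where
  "inv_filter B f \<U> = gen_filter (carrier B)
     ((\<lambda>U. {(b, b'). b \<in> carrier B \<and> b' \<in> carrier B \<and> (f b, f b') \<in> U}) ` \<U>)"

definition push_unif ::
    "'f signature \<Rightarrow> ('f, 'a) alg \<Rightarrow> ('f, 'b) alg \<Rightarrow> ('a \<Rightarrow> 'b) \<Rightarrow> ('a \<times> 'a) set set \<Rightarrow> ('b \<times> 'b) set set"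
  where
  "push_unif \<Omega> A B f \<U> =
     \<Sqinter>\<^bsub>Unif \<Omega> B\<^esub> {\<V> \<in> carrier (Unif \<Omega> B). inv_filter A f \<V> \<subseteq> \<U>}"

section \<open>The commutator\<close>

text \<open>A matrix is encoded as the pair of its rows, each row being a pair.\<close>

definition matrices :: "('f, 'a) alg \<Rightarrow> nat \<Rightarrow> nat \<Rightarrow> ('f, nat) trm \<Rightarrow> ('a \<times> 'a) set \<Rightarrow> ('a \<times> 'a) set
    \<Rightarrow> (('a \<times> 'a) \<times> ('a \<times> 'a)) set" where
  "matrices A n n' t U V =
     {((term_op A t (a @ b), term_op A t (a @ c)), (term_op A t (a' @ b), term_op A t (a' @ c)))
      | a a' b c. set a \<union> set a' \<union> set b \<union> set c \<subseteq> carrier A \<and>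
          length a = n \<and> length a' = n \<and> length b = n' \<and> length c = n' \<and>
          list_all2 (\<lambda>x y. (x, y) \<in> U) a a' \<and> list_all2 (\<lambda>x y. (x, y) \<in> V) b c}"

definition centralizes :: "'f signature \<Rightarrow> ('f, 'a) alg \<Rightarrow> ('a \<times> 'a) set set \<Rightarrow> ('a \<times> 'a) set set
    \<Rightarrow> ('a \<times> 'a) set set \<Rightarrow> bool" where
  "centralizes \<Omega> A \<U> \<V> \<W> \<longleftrightarrow> (\<forall>n n' t. nary_term \<Omega> (n + n') t \<longrightarrow>
     (\<forall>W\<in>\<W>. \<exists>U\<in>\<U>. \<exists>V\<in>\<V>. \<exists>W'\<in>\<W>. \<forall>u11 u12 u21 u22.
        ((u11, u12), (u21, u22)) \<in> matrices A n n' t U V \<longrightarrow> (u11, u12) \<in> W' \<longrightarrow> (u21, u22) \<in> W))"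

definition commutator :: "'f signature \<Rightarrow> ('f, 'a) alg \<Rightarrow> ('a \<times> 'a) set set \<Rightarrow> ('a \<times> 'a) set set
    \<Rightarrow> ('a \<times> 'a) set set" where
  "commutator \<Omega> A \<U> \<V> =
     (THE \<W>. least (Unif \<Omega> A) \<W> {\<W> \<in> carrier (Unif \<Omega> A). centralizes \<Omega> A \<U> \<V> \<W>})"

text \<open>The subalgebra of the square of \<open>A\<close> on the set of pairs \<open>\<alpha>\<close>.\<close>

definition con_alg :: "('f, 'a) alg \<Rightarrow> ('a \<times> 'a) set \<Rightarrow> ('f, 'a \<times> 'a) alg" where
  "con_alg A \<alpha> = \<lparr>carrier = \<alpha>, interp = (\<lambda>f ps. (interp A f (map fst ps), interp A f (map snd ps)))\<rparr>"

definition ker :: "('f, 'b) alg \<Rightarrow> ('b \<Rightarrow> 'a) \<Rightarrow> ('b \<times> 'b) set" where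
  "ker B f = {(b, b'). b \<in> carrier B \<and> b' \<in> carrier B \<and> f b = f b'}"

definition Delta_unif :: "'f signature \<Rightarrow> ('f, 'a) alg \<Rightarrow> ('a \<times> 'a) set \<Rightarrow> ('a \<times> 'a) set set
    \<Rightarrow> (('a \<times> 'a) \<times> ('a \<times> 'a)) set set" where
  "Delta_unif \<Omega> A \<alpha> \<U> = push_unif \<Omega> A (con_alg A \<alpha>) (\<lambda>a. (a, a)) \<U>"

definition commutator' :: "'f signature \<Rightarrow> ('f, 'a) alg \<Rightarrow> ('a \<times> 'a) set \<Rightarrow> ('a \<times> 'a) set set
    \<Rightarrow> ('a \<times> 'a) set set" where
  "commutator' \<Omega> A \<alpha> \<U> = (THE \<W>. \<W> \<in> carrier (Unif \<Omega> A) \<and>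
     (let B = con_alg A \<alpha>; L = Unif \<Omega> B
      in inv_filter B snd \<W> = (Delta_unif \<Omega> A \<alpha> \<U> \<sqinter>\<^bsub>L\<^esub> Ug B (ker B fst)) \<squnion>\<^bsub>L\<^esub> Ug B (ker B snd)))"

end

theory Submission
  imports Defs
begin

text \<open>For the inequality, \<open>[\<alpha>,\<U>]'\<close> is shown to satisfy the centralizing condition. Given a matrix
  with almost equal entries in its first row, Day terms \<open>m\<^sub>i\<close> give a chain of bounded length
  \<open>m\<^sub>i(u\<^sub>2\<^sub>1, u\<^sub>1\<^sub>1, u\<^sub>1\<^sub>2, u\<^sub>2\<^sub>2)\<close> from \<open>u\<^sub>2\<^sub>1\<close> to \<open>u\<^sub>2\<^sub>2\<close>. One kind of link is small because \<open>u\<^sub>1\<^sub>1\<close> and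
  \<open>u\<^sub>1\<^sub>2\<close> are close; the other because \<open>m\<^sub>i(u\<^sub>2\<^sub>1, u\<^sub>1\<^sub>1, u\<^sub>1\<^sub>2, u\<^sub>2\<^sub>2)\<close> and \<open>m\<^sub>i(u\<^sub>2\<^sub>1, u\<^sub>2\<^sub>1, u\<^sub>2\<^sub>2, u\<^sub>2\<^sub>2)\<close> are
  related by \<open>\<Delta>\<^bsub>\<alpha>,\<U>\<^esub>\<close> over a common first coordinate. The length of the chain does not depend on the
  matrix, so that an entourage can be chosen in advance whose corresponding power is small.

  For the converse, \<open>\<Delta>\<^bsub>\<alpha>,\<U>\<^esub>\<close> must be bounded from above. In the presence of a group structure and
  for a centralized \<open>\<W>\<close>, the relations between \<open>\<langle>x, y\<rangle>\<close> and \<open>\<langle>z, w\<rangle>\<close> expressing that \<open>x\<close> is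
  \<open>\<U>\<close>-close to \<open>z\<close> and \<open>y x\<inverse> z\<close> is \<open>\<W>\<close>-close to \<open>w\<close> generate a compatible uniformity on \<open>A(\<alpha>)\<close>;
  for \<open>x = z\<close> they say that \<open>y\<close> is \<open>\<W>\<close>-close to \<open>w\<close>.\<close>


section \<open>Generating filters and uniformities\<close>

lemma gen_filter_filter: "is_filter_on S (gen_filter S \<G>)"
  unfolding is_filter_on_def
proof (intro conjI ballI allI impI)
  show "S \<times> S \<in> gen_filter S \<G>" by (auto simp: gen_filter_def intro!: exI[of _ "{}"])
next
  fix U V assume "U \<in> gen_filter S \<G>" "V \<in> gen_filter S \<G>"
  then obtain F F' where "finite F" "F \<subseteq> \<G>" "(S \<times> S) \<inter> \<Inter>F \<subseteq> U" "U \<subseteq> S \<times> S"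
    and "finite F'" "F' \<subseteq> \<G>" "(S \<times> S) \<inter> \<Inter>F' \<subseteq> V" "V \<subseteq> S \<times> S"
    unfolding gen_filter_def by blast
  then show "U \<inter> V \<in> gen_filter S \<G>"
    unfolding gen_filter_def mem_Collect_eq by (intro conjI exI[of _ "F \<union> F'"]) blast+
next
  fix U V assume "U \<in> gen_filter S \<G>" "U \<subseteq> V \<and> V \<subseteq> S \<times> S"
  then show "V \<in> gen_filter S \<G>" unfolding gen_filter_def mem_Collect_eq by (elim conjE exE, intro conjI exI) (assumption | rule order_trans)+
qed (simp add: gen_filter_def subset_iff)

lemma gen_filter_superset: "\<G> \<subseteq> Pow (S \<times> S) \<Longrightarrow> \<G> \<subseteq> gen_filter S \<G>"
proof
  fix U assume "\<G> \<subseteq> Pow (S \<times> S)" "U \<in> \<G>"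
  then show "U \<in> gen_filter S \<G>" by (auto simp: gen_filter_def intro!: exI[of _ "{U}"])
qed

text \<open>A member of the generated filter arises from generators by a finite intersection, which
  may be empty, followed by one enlargement. Induction over the finite set of generators covers the
  intersection; \<open>top\<close> is its empty case. Most existence claims about generated filters
  below are proved by this rule.\<close>

lemma gen_filter_induct [consumes 1, case_names top base inter mono]:
  assumes "U \<in> gen_filter S \<G>"
    and "P (S \<times> S)"
    and "\<And>U. U \<in> \<G> \<Longrightarrow> P U"
    and inter: "\<And>U V. P U \<Longrightarrow> P V \<Longrightarrow> P (U \<inter> V)"
    and mono: "\<And>U V. P U \<Longrightarrow> U \<subseteq> V \<Longrightarrow> V \<subseteq> S \<times> S \<Longrightarrow> P V"
  shows "P U"
proof -
  obtain F where F: "finite F" "F \<subseteq> \<G>" "(S \<times> S) \<inter> \<Inter>F \<subseteq> U" "U \<subseteq> S \<times> S"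
    using assms(1) unfolding gen_filter_def by blast
  have "P ((S \<times> S) \<inter> \<Inter>F)" using F(1,2)
  proof (induction F rule: finite_induct)
    case (insert V F)
    then have "P (V \<inter> (S \<times> S \<inter> \<Inter>F))" using assms(3) inter by blast
    moreover have "V \<inter> (S \<times> S \<inter> \<Inter>F) = S \<times> S \<inter> \<Inter>(insert V F)" by auto
    ultimately show ?case by simp
  qed (use assms(2) in simp)
  then show ?thesis using mono F by blast
qed

lemma gen_filter_least:
  assumes "is_filter_on S \<F>" "\<G> \<subseteq> \<F>"
  shows "gen_filter S \<G> \<subseteq> \<F>"
proof
  fix U assume "U \<in> gen_filter S \<G>"
  then show "U \<in> \<F>"
    by (induction rule: gen_filter_induct) (use assms in \<open>auto simp: is_filter_on_def\<close>)
qed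

lemma filterD:
  assumes "is_filter_on S \<U>"
  shows "U \<in> \<U> \<Longrightarrow> U \<subseteq> S \<times> S" "S \<times> S \<in> \<U>" "U \<in> \<U> \<Longrightarrow> V \<in> \<U> \<Longrightarrow> U \<inter> V \<in> \<U>"
    "U \<in> \<U> \<Longrightarrow> U \<subseteq> V \<Longrightarrow> V \<subseteq> S \<times> S \<Longrightarrow> V \<in> \<U>"
  using assms unfolding is_filter_on_def by auto

text \<open>Merges finitely many choices of an entourage into one: the choices made for the
  arguments of an operation, or for the terms of a Day chain.\<close>

lemma filter_finite_Int:
  assumes "is_filter_on S \<U>" "finite I" "\<And>i. i \<in> I \<Longrightarrow> f i \<in> \<U>"
  shows "\<exists>U\<in>\<U>. \<forall>i\<in>I. U \<subseteq> f i"
  using assms(2,3)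
proof (induction I rule: finite_induct)
  case empty
  then show ?case using filterD[OF assms(1)] by blast
next
  case (insert i I)
  then obtain U where "U \<in> \<U>" "\<forall>i\<in>I. U \<subseteq> f i" by blast
  then show ?case using insert.prems filterD(3)[OF assms(1), of U "f i"] by (intro bexI[of _ "U \<inter> f i"]) auto
qed

section \<open>Uniformities and their compatibility with the operations\<close>

lemma Unif_simps [simp]:
  "\<U> \<in> carrier (Unif \<Omega> A) \<longleftrightarrow> is_uniformity (carrier A) \<U> \<and> is_compatible \<Omega> A \<U>"
  "\<U> \<sqsubseteq>\<^bsub>Unif \<Omega> A\<^esub> \<V> \<longleftrightarrow> \<V> \<subseteq> \<U>"
  by (simp_all add: Unif_def)

lemma uniformityD:
  assumes "is_uniformity S \<U>"
  shows "is_filter_on S \<U>" "U \<in> \<U> \<Longrightarrow> refl_on S U" "U \<in> \<U> \<Longrightarrow> U\<inverse> \<in> \<U>"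
    "U \<in> \<U> \<Longrightarrow> \<exists>V\<in>\<U>. V O V \<subseteq> U"
  using assms unfolding is_uniformity_def by auto

lemma compatibleE:
  assumes "is_compatible \<Omega> A \<U>" "\<Omega> f = Some n" "U \<in> \<U>"
  obtains V where "V \<in> \<U>" "\<And>xs ys. length xs = n \<Longrightarrow> list_all2 (\<lambda>x y. (x, y) \<in> V) xs ys
    \<Longrightarrow> (interp A f xs, interp A f ys) \<in> U"
proof -
  have "\<exists>V\<in>\<U>. \<forall>xs ys. length xs = n \<longrightarrow> list_all2 (\<lambda>x y. (x, y) \<in> V) xs ys
    \<longrightarrow> (interp A f xs, interp A f ys) \<in> U"
    using assms unfolding is_compatible_def by blast
  then show thesis using that by (elim bexE) simp
qed

text \<open>Halve twice and intersect: two of the three factors compose into \<open>V1\<close>, the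
  third lies in \<open>V1\<close>, and \<open>V1 O V1\<close> is inside \<open>U\<close>. Threefold
  products are needed where an entourage is composed with the kernel of a homomorphism on both
  sides.\<close>

lemma uniformity_comp3:
  assumes "is_uniformity S \<U>" "U \<in> \<U>"
  shows "\<exists>V\<in>\<U>. V \<subseteq> U \<and> V O V O V \<subseteq> U"
proof -
  note u = uniformityD[OF assms(1)]
  obtain V1 where V1: "V1 \<in> \<U>" "V1 O V1 \<subseteq> U" using u(4) assms by blast
  obtain V where V: "V \<in> \<U>" "V O V \<subseteq> V1" using u(4) V1 by blast
  have "V1 \<inter> V \<in> \<U>" using filterD(3)[OF u(1)] V V1 by auto
  moreover have "refl_on S V1" "refl_on S V" "V \<subseteq> S \<times> S" "V1 \<subseteq> S \<times> S"
    using u V V1 filterD(1)[OF u(1)] by auto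
  ultimately show ?thesis using V V1
    by (intro bexI[of _ "V1 \<inter> V"]) (unfold refl_on_def, blast+)
qed

text \<open>Each uniformity axiom, and compatibility, passes from relations to their intersections
  and enlargements, so it is enough to test the generators. The witness may be any member of the
  generated filter, not only a generator.\<close>

lemma gen_filter_Unif:
  assumes A: "is_algebra \<Omega> A"
    and sub: "\<G> \<subseteq> Pow (carrier A \<times> carrier A)"
    and refl: "\<And>U. U \<in> \<G> \<Longrightarrow> refl_on (carrier A) U"
    and sym: "\<And>U. U \<in> \<G> \<Longrightarrow> \<exists>V\<in>gen_filter (carrier A) \<G>. V \<subseteq> U\<inverse>"
    and comp: "\<And>U. U \<in> \<G> \<Longrightarrow> \<exists>V\<in>gen_filter (carrier A) \<G>. V O V \<subseteq> U"
    and ops: "\<And>U f n. U \<in> \<G> \<Longrightarrow> \<Omega> f = Some n \<Longrightarrow> \<exists>V\<in>gen_filter (carrier A) \<G>. \<forall>xs ys.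
      length xs = n \<longrightarrow> list_all2 (\<lambda>x y. (x, y) \<in> V) xs ys \<longrightarrow> (interp A f xs, interp A f ys) \<in> U"
  shows "gen_filter (carrier A) \<G> \<in> carrier (Unif \<Omega> A)"
proof -
  let ?S = "carrier A" let ?F = "gen_filter (carrier A) \<G>"
  note F = filterD[OF gen_filter_filter[of ?S \<G>]]
  have "refl_on ?S U" if "U \<in> ?F" for U
    using that by (induction rule: gen_filter_induct) (use refl in \<open>auto simp: refl_on_def\<close>)
  moreover have "U\<inverse> \<in> ?F" if "U \<in> ?F" for U
    using that
  proof (induction rule: gen_filter_induct)
    case (base U)
    then obtain V where V: "V \<in> ?F" "V \<subseteq> U\<inverse>" using sym by blast
    have "U\<inverse> \<subseteq> ?S \<times> ?S" using base sub by auto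
    then show ?case using F(4) V by blast
  next
    case (mono U V)
    then show ?case using F(4)[of "U\<inverse>" "V\<inverse>"] by blast
  next
    case (inter U V)
    then show ?case using F(3) by (simp add: converse_Int)
  qed (use F(2) in \<open>simp add: converse_Times\<close>)
  moreover have "\<exists>V\<in>?F. V O V \<subseteq> U" if "U \<in> ?F" for U
    using that
  proof (induction rule: gen_filter_induct)
    case top
    then show ?case using F(1,2) by blast
  next
    case (inter U V)
    then obtain U' V' where "U' \<in> ?F" "U' O U' \<subseteq> U" "V' \<in> ?F" "V' O V' \<subseteq> V" by blast
    then show ?case using F(3)[of U' V'] by (intro bexI[of _ "U' \<inter> V'"]) auto
  next
    case (base U)
    then show ?case by (rule comp)
  next
    case (mono U V)
    then show ?case by (meson subset_trans)
  qed
  moreover have "\<exists>V\<in>?F. \<forall>xs ys. length xs = n \<longrightarrow> list_all2 (\<lambda>x y. (x, y) \<in> V) xs ys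
      \<longrightarrow> (interp A f xs, interp A f ys) \<in> U" if "U \<in> ?F" "\<Omega> f = Some n" for U f n
    using that(1)
  proof (induction rule: gen_filter_induct)
    case top
    have "(interp A f xs, interp A f ys) \<in> ?S \<times> ?S"
      if "length xs = n" "list_all2 (\<lambda>x y. (x, y) \<in> ?S \<times> ?S) xs ys" for xs ys
    proof -
      have "set xs \<subseteq> ?S" "set ys \<subseteq> ?S" "length ys = n"
        using that by (auto simp: list_all2_conv_all_nth in_set_conv_nth)
      then show ?thesis using A that \<open>\<Omega> f = Some n\<close> unfolding is_algebra_def by auto
    qed
    then show ?case using F(2) by blast
  next
    case (base U)
    then show ?case using ops that(2) by blast
  next
    case (inter U V)
    then obtain U' V' where "U' \<in> ?F" "V' \<in> ?F"
      and *: "\<forall>xs ys. length xs = n \<longrightarrow> list_all2 (\<lambda>x y. (x, y) \<in> U') xs ys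
      \<longrightarrow> (interp A f xs, interp A f ys) \<in> U"
      "\<forall>xs ys. length xs = n \<longrightarrow> list_all2 (\<lambda>x y. (x, y) \<in> V') xs ys
      \<longrightarrow> (interp A f xs, interp A f ys) \<in> V" by blast
    moreover have "list_all2 (\<lambda>x y. (x, y) \<in> U') xs ys \<and> list_all2 (\<lambda>x y. (x, y) \<in> V') xs ys"
      if "list_all2 (\<lambda>x y. (x, y) \<in> U' \<inter> V') xs ys" for xs ys
      using that by (auto elim: list_all2_mono)
    ultimately show ?case using F(3)[of U' V'] by (intro bexI[of _ "U' \<inter> V'"]) blast+
  next
    case (mono U V)
    then show ?case by blast
  qed
  ultimately show ?thesis
    using gen_filter_filter by (auto simp: is_uniformity_def is_compatible_def)
qed

section \<open>Lattice operations on compatible uniformities\<close>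

text \<open>Every condition on a generator is witnessed inside the uniformity from which the
  generator comes. As the order is reverse inclusion, the filter generated by the union is the meet
  of the family.\<close>

lemma Unif_Meet_carrier:
  assumes "is_algebra \<Omega> A" "F \<subseteq> carrier (Unif \<Omega> A)"
  shows "gen_filter (carrier A) (\<Union>F) \<in> carrier (Unif \<Omega> A)"
proof -
  have sub: "\<Union>F \<subseteq> Pow (carrier A \<times> carrier A)"
    using assms(2) by (fastforce simp: is_uniformity_def is_filter_on_def)
  note sup = gen_filter_superset[OF sub]
  show ?thesis
  proof (rule gen_filter_Unif[OF assms(1) sub])
    fix U assume "U \<in> \<Union>F"
    then obtain \<U> where U: "U \<in> \<U>" "\<U> \<in> F" by blast
    then have u: "is_uniformity (carrier A) \<U>" "is_compatible \<Omega> A \<U>" using assms by auto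
    have in_gen: "V \<in> gen_filter (carrier A) (\<Union>F)" if "V \<in> \<U>" for V using that U sup by blast
    show "refl_on (carrier A) U" using uniformityD(2)[OF u(1) U(1)] .
    show "\<exists>V\<in>gen_filter (carrier A) (\<Union>F). V \<subseteq> U\<inverse>"
      using in_gen[OF uniformityD(3)[OF u(1) U(1)]] by blast
    show "\<exists>V\<in>gen_filter (carrier A) (\<Union>F). V O V \<subseteq> U"
      using uniformityD(4)[OF u(1) U(1)] in_gen by blast
    fix f n assume "\<Omega> f = Some n"
    then show "\<exists>V\<in>gen_filter (carrier A) (\<Union>F). \<forall>xs ys.
      length xs = n \<longrightarrow> list_all2 (\<lambda>x y. (x, y) \<in> V) xs ys \<longrightarrow> (interp A f xs, interp A f ys) \<in> U"
      using u(2) U in_gen unfolding is_compatible_def by meson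
  qed
qed

lemma Unif_bounds:
  assumes "F \<subseteq> carrier (Unif \<Omega> A)"
  shows "Lower (Unif \<Omega> A) F = {\<V> \<in> carrier (Unif \<Omega> A). \<forall>\<U>\<in>F. \<U> \<subseteq> \<V>}"
    and "Upper (Unif \<Omega> A) F = {\<V> \<in> carrier (Unif \<Omega> A). \<forall>\<U>\<in>F. \<V> \<subseteq> \<U>}"
  using assms unfolding Lower_def Upper_def by (auto simp del: Unif_simps(1) simp: subset_iff)

lemma Unif_greatest:
  assumes "is_algebra \<Omega> A" "F \<subseteq> carrier (Unif \<Omega> A)"
  shows "greatest (Unif \<Omega> A) (gen_filter (carrier A) (\<Union>F)) (Lower (Unif \<Omega> A) F)"
proof -
  have sub: "\<Union>F \<subseteq> Pow (carrier A \<times> carrier A)"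
    using assms(2) by (fastforce simp: is_uniformity_def is_filter_on_def)
  have "gen_filter (carrier A) (\<Union>F) \<subseteq> \<V>"
    if "\<V> \<in> carrier (Unif \<Omega> A)" "\<And>\<U>. \<U> \<in> F \<Longrightarrow> \<U> \<subseteq> \<V>" for \<V>
    using that by (intro gen_filter_least) (auto simp: is_uniformity_def)
  moreover have "\<U> \<subseteq> gen_filter (carrier A) (\<Union>F)" if "\<U> \<in> F" for \<U>
    using gen_filter_superset[OF sub] that by blast
  ultimately show ?thesis
    using Unif_Meet_carrier[OF assms] unfolding greatest_def Unif_bounds[OF assms(2)] by auto
qed

lemma Unif_Inf:
  assumes "is_algebra \<Omega> A" "F \<subseteq> carrier (Unif \<Omega> A)"
  shows "\<Sqinter>\<^bsub>Unif \<Omega> A\<^esub> F = gen_filter (carrier A) (\<Union>F)"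
proof -
  have "\<V> = gen_filter (carrier A) (\<Union>F)" if "greatest (Unif \<Omega> A) \<V> (Lower (Unif \<Omega> A) F)" for \<V>
    using that Unif_greatest[OF assms] unfolding greatest_def by (metis Unif_simps(2) subset_antisym)
  then show ?thesis
    unfolding inf_def using Unif_greatest[OF assms] by (rule some_equality[rotated])
qed

text \<open>Unlike the meet, the join is not described by generators from the given uniformities. It
  is obtained as the meet of all upper bounds.\<close>

lemma Unif_least:
  assumes "is_algebra \<Omega> A" "F \<subseteq> carrier (Unif \<Omega> A)"
  shows "\<exists>\<V>. least (Unif \<Omega> A) \<V> (Upper (Unif \<Omega> A) F)"
proof -
  let ?G = "Upper (Unif \<Omega> A) F"
  have G: "?G \<subseteq> carrier (Unif \<Omega> A)" by (auto simp: Upper_def)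
  have sub: "\<Union>?G \<subseteq> Pow (carrier A \<times> carrier A)"
    using G by (fastforce simp: is_uniformity_def is_filter_on_def)
  have "gen_filter (carrier A) (\<Union>?G) \<subseteq> \<U>" if "\<U> \<in> F" for \<U>
    unfolding Unif_bounds[OF assms(2)]
    using that assms(2) by (intro gen_filter_least) (auto simp: is_uniformity_def)
  moreover have "\<V> \<subseteq> gen_filter (carrier A) (\<Union>?G)" if "\<V> \<in> ?G" for \<V>
    using gen_filter_superset[OF sub] that by blast
  ultimately have "least (Unif \<Omega> A) (gen_filter (carrier A) (\<Union>?G)) ?G"
    using Unif_Meet_carrier[OF assms(1) G]
    unfolding least_def Unif_bounds[OF assms(2)] by auto
  then show ?thesis by blast
qed

lemma Unif_join:
  assumes "is_algebra \<Omega> A" "\<U> \<in> carrier (Unif \<Omega> A)" "\<V> \<in> carrier (Unif \<Omega> A)"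
  shows "\<U> \<squnion>\<^bsub>Unif \<Omega> A\<^esub> \<V> \<in> carrier (Unif \<Omega> A)"
    and "\<U> \<squnion>\<^bsub>Unif \<Omega> A\<^esub> \<V> \<subseteq> \<U>" and "\<U> \<squnion>\<^bsub>Unif \<Omega> A\<^esub> \<V> \<subseteq> \<V>"
    and "\<W> \<in> carrier (Unif \<Omega> A) \<Longrightarrow> \<W> \<subseteq> \<U> \<Longrightarrow> \<W> \<subseteq> \<V> \<Longrightarrow> \<W> \<subseteq> \<U> \<squnion>\<^bsub>Unif \<Omega> A\<^esub> \<V>"
proof -
  let ?F = "{\<U>, \<V>}"
  have F: "?F \<subseteq> carrier (Unif \<Omega> A)" using assms by simp
  have "least (Unif \<Omega> A) (\<U> \<squnion>\<^bsub>Unif \<Omega> A\<^esub> \<V>) (Upper (Unif \<Omega> A) ?F)"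
    unfolding join_def sup_def using Unif_least[OF assms(1) F] by (rule someI_ex)
  then have "\<U> \<squnion>\<^bsub>Unif \<Omega> A\<^esub> \<V> \<in> Upper (Unif \<Omega> A) ?F"
    and *: "\<And>\<W>. \<W> \<in> Upper (Unif \<Omega> A) ?F \<Longrightarrow> \<W> \<subseteq> \<U> \<squnion>\<^bsub>Unif \<Omega> A\<^esub> \<V>"
    by (auto simp: least_def)
  then show "\<U> \<squnion>\<^bsub>Unif \<Omega> A\<^esub> \<V> \<in> carrier (Unif \<Omega> A)"
    and "\<U> \<squnion>\<^bsub>Unif \<Omega> A\<^esub> \<V> \<subseteq> \<U>" and "\<U> \<squnion>\<^bsub>Unif \<Omega> A\<^esub> \<V> \<subseteq> \<V>"
    using F by (auto simp: Upper_def)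
  assume "\<W> \<in> carrier (Unif \<Omega> A)" "\<W> \<subseteq> \<U>" "\<W> \<subseteq> \<V>"
  then show "\<W> \<subseteq> \<U> \<squnion>\<^bsub>Unif \<Omega> A\<^esub> \<V>" by (intro *) (auto simp: Upper_def)
qed

text \<open>Both filters contain the full relation, so a generator from one of them can be paired
  with the full relation from the other. Hence the intersections \<open>U \<inter> V\<close> form a
  base of the meet, which is the last claim.\<close>

lemma Unif_meet:
  assumes "is_algebra \<Omega> A" "\<U> \<in> carrier (Unif \<Omega> A)" "\<V> \<in> carrier (Unif \<Omega> A)"
  shows "\<U> \<sqinter>\<^bsub>Unif \<Omega> A\<^esub> \<V> \<in> carrier (Unif \<Omega> A)"
    and "\<U> \<subseteq> \<U> \<sqinter>\<^bsub>Unif \<Omega> A\<^esub> \<V>" and "\<V> \<subseteq> \<U> \<sqinter>\<^bsub>Unif \<Omega> A\<^esub> \<V>"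
    and "P \<in> \<U> \<sqinter>\<^bsub>Unif \<Omega> A\<^esub> \<V> \<Longrightarrow> \<exists>U\<in>\<U>. \<exists>V\<in>\<V>. U \<inter> V \<subseteq> P"
proof -
  have F: "{\<U>, \<V>} \<subseteq> carrier (Unif \<Omega> A)" using assms by simp
  have eq: "\<U> \<sqinter>\<^bsub>Unif \<Omega> A\<^esub> \<V> = gen_filter (carrier A) (\<U> \<union> \<V>)"
    unfolding meet_def using Unif_Inf[OF assms(1) F] by simp
  have fl: "is_filter_on (carrier A) \<U>" "is_filter_on (carrier A) \<V>"
    using assms by (auto simp: is_uniformity_def)
  have "\<U> \<union> \<V> \<subseteq> gen_filter (carrier A) (\<U> \<union> \<V>)"
    using filterD(1)[OF fl(1)] filterD(1)[OF fl(2)] by (intro gen_filter_superset) blast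
  then show "\<U> \<subseteq> \<U> \<sqinter>\<^bsub>Unif \<Omega> A\<^esub> \<V>" "\<V> \<subseteq> \<U> \<sqinter>\<^bsub>Unif \<Omega> A\<^esub> \<V>" by (auto simp: eq)
  show "\<U> \<sqinter>\<^bsub>Unif \<Omega> A\<^esub> \<V> \<in> carrier (Unif \<Omega> A)"
    using Unif_Meet_carrier[OF assms(1) F] by (simp add: eq)
  assume "P \<in> \<U> \<sqinter>\<^bsub>Unif \<Omega> A\<^esub> \<V>"
  then have "P \<in> gen_filter (carrier A) (\<U> \<union> \<V>)" by (simp add: eq)
  then show "\<exists>U\<in>\<U>. \<exists>V\<in>\<V>. U \<inter> V \<subseteq> P"
  proof (induction rule: gen_filter_induct)
    case (base U)
    have *: "carrier A \<times> carrier A \<in> \<U>" "carrier A \<times> carrier A \<in> \<V>"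
      using filterD(2)[OF fl(1)] filterD(2)[OF fl(2)] by auto
    from base show ?case
    proof
      assume "U \<in> \<U>"
      then show ?case using *(2) by (intro bexI[of _ U] bexI[of _ "carrier A \<times> carrier A"]) auto
    next
      assume "U \<in> \<V>"
      then show ?case using *(1) by (intro bexI[of _ "carrier A \<times> carrier A"] bexI[of _ U]) auto
    qed
  next
    case (inter P Q)
    then obtain U V U' V' where "U \<in> \<U>" "V \<in> \<V>" "U \<inter> V \<subseteq> P" "U' \<in> \<U>" "V' \<in> \<V>" "U' \<inter> V' \<subseteq> Q"
      by blast
    then show ?case using filterD(3)[OF fl(1)] filterD(3)[OF fl(2)]
      by (intro bexI[of _ "U \<inter> U'"] bexI[of _ "V \<inter> V'"]) auto
  next
    case top
    show ?case
      using filterD(2)[OF fl(1)] filterD(2)[OF fl(2)]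
      by (intro bexI[of _ "carrier A \<times> carrier A"]) auto
  next
    case (mono P Q)
    then show ?case by (meson order_trans)
  qed
qed

text \<open>The congruence \<theta> is the least entourage of its filter; it is its own half by
  transitivity, and it witnesses compatibility for every entourage.\<close>

lemma Ug_Unif:
  assumes "is_algebra \<Omega> A" "is_congruence \<Omega> A \<theta>"
  shows "Ug A \<theta> \<in> carrier (Unif \<Omega> A)"
proof -
  have e: "equiv (carrier A) \<theta>" using assms by (simp add: is_congruence_def)
  then have \<theta>: "\<theta> \<subseteq> carrier A \<times> carrier A" "refl_on (carrier A) \<theta>" "\<theta>\<inverse> = \<theta>" "\<theta> O \<theta> \<subseteq> \<theta>"
    by (auto simp: equiv_def sym_conv_converse_eq trans_O_subset)
  have "is_uniformity (carrier A) (Ug A \<theta>)"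
    unfolding is_uniformity_def
  proof (intro conjI ballI)
    show "is_filter_on (carrier A) (Ug A \<theta>)"
      using \<theta>(1) by (auto simp: is_filter_on_def Ug_def)
    fix U assume "U \<in> Ug A \<theta>"
    then have U: "U \<subseteq> carrier A \<times> carrier A" "\<theta> \<subseteq> U" by (auto simp: Ug_def)
    show "refl_on (carrier A) U" using U \<theta>(2) by (auto simp: refl_on_def)
    have "\<theta>\<inverse> \<subseteq> U\<inverse>" using U(2) by auto
    then show "U\<inverse> \<in> Ug A \<theta>" using U(1) unfolding \<theta>(3) by (auto simp: Ug_def)
    show "\<exists>V\<in>Ug A \<theta>. V O V \<subseteq> U"
      using U(2) \<theta>(1,4) by (intro bexI[of _ \<theta>]) (auto simp: Ug_def)
  qed
  moreover have "is_compatible \<Omega> A (Ug A \<theta>)"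
    unfolding is_compatible_def
  proof (intro allI impI ballI bexI[of _ \<theta>])
    show "\<theta> \<in> Ug A \<theta>" using \<theta>(1) by (simp add: Ug_def)
    fix f n U xs ys assume "\<Omega> f = Some n" "U \<in> Ug A \<theta>" "length xs = n"
      "list_all2 (\<lambda>x y. (x, y) \<in> \<theta>) xs ys"
    then show "(interp A f xs, interp A f ys) \<in> U"
      using assms(2) unfolding is_congruence_def Ug_def by blast
  qed
  ultimately show ?thesis by simp
qed

section \<open>Terms and homomorphisms\<close>

text \<open>Compatibility extends from basic operations to terms by induction. At an application,
  the entourages found for the finitely many arguments are intersected. The resulting
  \<open>V\<close> depends on the term and on \<open>U\<close>, but serves all assignments at
  once.\<close>

lemma compatible_eval:
  assumes A: "is_algebra \<Omega> A" and u: "\<U> \<in> carrier (Unif \<Omega> A)" and "wf_trm \<Omega> t" "U \<in> \<U>"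
  shows "\<exists>V\<in>\<U>. \<forall>\<rho> \<sigma>. (\<forall>v\<in>vars t. (\<rho> v, \<sigma> v) \<in> V) \<longrightarrow> (eval A \<rho> t, eval A \<sigma> t) \<in> U"
  using assms(3,4)
proof (induction t arbitrary: U)
  case (Var v)
  then show ?case by auto
next
  case (App f ts)
  have fl: "is_filter_on (carrier A) \<U>" using u by (auto simp: is_uniformity_def)
  obtain U' where U': "U' \<in> \<U>" "\<And>xs ys. length xs = length ts
      \<Longrightarrow> list_all2 (\<lambda>x y. (x, y) \<in> U') xs ys \<Longrightarrow> (interp A f xs, interp A f ys) \<in> U"
    by (rule compatibleE[of \<Omega> A \<U> f "length ts" U]) (use u App.prems in auto)
  have "\<exists>V\<in>\<U>. \<forall>\<rho> \<sigma>. (\<forall>v\<in>vars t. (\<rho> v, \<sigma> v) \<in> V) \<longrightarrow> (eval A \<rho> t, eval A \<sigma> t) \<in> U'"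
    if "t \<in> set ts" for t
    using App.IH[OF that] App.prems U'(1) that by (auto simp: list_all_iff)
  then obtain W where W: "\<And>t. t \<in> set ts \<Longrightarrow> W t \<in> \<U>"
    "\<And>t \<rho> \<sigma>. t \<in> set ts \<Longrightarrow> (\<forall>v\<in>vars t. (\<rho> v, \<sigma> v) \<in> W t) \<Longrightarrow> (eval A \<rho> t, eval A \<sigma> t) \<in> U'"
    by metis
  obtain V where V: "V \<in> \<U>" "\<And>t. t \<in> set ts \<Longrightarrow> V \<subseteq> W t"
    using filter_finite_Int[OF fl, of "set ts" W] W(1) by auto
  show ?case
  proof (intro bexI[OF _ V(1)] allI impI)
    fix \<rho> \<sigma> assume h: "\<forall>v\<in>vars (App f ts). (\<rho> v, \<sigma> v) \<in> V"
    have "(eval A \<rho> t, eval A \<sigma> t) \<in> U'" if "t \<in> set ts" for t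
      using h V(2)[OF that] that by (intro W(2)) auto
    then have "list_all2 (\<lambda>x y. (x, y) \<in> U') (map (eval A \<rho>) ts) (map (eval A \<sigma>) ts)"
      by (simp add: list_all2_conv_all_nth)
    then show "(eval A \<rho> (App f ts), eval A \<sigma> (App f ts)) \<in> U" using U'(2) by simp
  qed
qed

lemma eval_cong: "(\<And>v. v \<in> vars t \<Longrightarrow> \<rho> v = \<sigma> v) \<Longrightarrow> eval A \<rho> t = eval A \<sigma> t"
proof (induction t)
  case (App f ts)
  then have "map (eval A \<rho>) ts = map (eval A \<sigma>) ts" by auto
  then show ?case by (simp only: eval.simps)
qed simp

text \<open>Stated for the variables that occur, so that it covers \<open>term_op\<close>, where
  \<open>xs ! i\<close> is unspecified beyond the end of the list.\<close>

lemma eval_in_carrier: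
  assumes "is_algebra \<Omega> A" "wf_trm \<Omega> t" "\<And>v. v \<in> vars t \<Longrightarrow> \<rho> v \<in> carrier A"
  shows "eval A \<rho> t \<in> carrier A"
  using assms(2,3)
proof (induction t)
  case (App f ts)
  then have "set (map (eval A \<rho>) ts) \<subseteq> carrier A" by (auto simp: list_all_iff)
  then show ?case using App.prems assms(1) unfolding is_algebra_def by simp
qed simp

text \<open>Used to compose the group terms with a basic operation into the single term to which the
  centralizing condition is applied.\<close>

primrec subst :: "('v \<Rightarrow> ('f, 'w) trm) \<Rightarrow> ('f, 'v) trm \<Rightarrow> ('f, 'w) trm" where
  "subst \<sigma> (Var v) = \<sigma> v"
| "subst \<sigma> (App f ts) = App f (map (subst \<sigma>) ts)"

lemma eval_subst: "eval A \<rho> (subst \<sigma> t) = eval A (\<lambda>v. eval A \<rho> (\<sigma> v)) t"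
proof (induction t)
  case (App f ts)
  then show ?case by (simp add: o_def cong: map_cong)
qed simp

lemma wf_subst: "wf_trm \<Omega> t \<Longrightarrow> (\<And>v. v \<in> vars t \<Longrightarrow> wf_trm \<Omega> (\<sigma> v)) \<Longrightarrow> wf_trm \<Omega> (subst \<sigma> t)"
  by (induction t) (auto simp: list_all_iff)

lemma vars_subst: "vars (subst \<sigma> t) = (\<Union>v\<in>vars t. vars (\<sigma> v))"
  by (induction t) auto

section \<open>The algebra A(\<alpha>) and its projections\<close>

lemma con_alg_carrier [simp]: "carrier (con_alg A \<alpha>) = \<alpha>"
  by (simp add: con_alg_def)

lemma congruenceD:
  assumes "is_congruence \<Omega> A \<theta>"
  shows "\<theta> \<subseteq> carrier A \<times> carrier A" "x \<in> carrier A \<Longrightarrow> (x, x) \<in> \<theta>"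
    "(x, y) \<in> \<theta> \<Longrightarrow> (y, x) \<in> \<theta>" "(x, y) \<in> \<theta> \<Longrightarrow> (y, z) \<in> \<theta> \<Longrightarrow> (x, z) \<in> \<theta>"
  using assms unfolding is_congruence_def equiv_def by (auto dest: refl_onD symD transD)

lemma con_alg_algebra:
  assumes "is_congruence \<Omega> A \<alpha>"
  shows "is_algebra \<Omega> (con_alg A \<alpha>)"
  unfolding is_algebra_def
proof (intro allI impI)
  fix f n ps
  assume "\<Omega> f = Some n" "length ps = n" "set ps \<subseteq> carrier (con_alg A \<alpha>)"
  moreover from this have "list_all2 (\<lambda>x y. (x, y) \<in> \<alpha>) (map fst ps) (map snd ps)"
    by (auto simp: list_all2_conv_all_nth)
  ultimately show "interp (con_alg A \<alpha>) f ps \<in> carrier (con_alg A \<alpha>)"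
    using assms unfolding is_congruence_def con_alg_def by simp
qed

lemma eval_con_alg:
  "eval (con_alg A \<alpha>) \<rho> t = (eval A (\<lambda>v. fst (\<rho> v)) t, eval A (\<lambda>v. snd (\<rho> v)) t)"
proof (induction t)
  case (App f ts)
  then show ?case by (simp add: con_alg_def o_def cong: map_cong)
qed simp

definition alg_hom :: "'f signature \<Rightarrow> ('f, 'b) alg \<Rightarrow> ('f, 'a) alg \<Rightarrow> ('b \<Rightarrow> 'a) \<Rightarrow> bool" where
  "alg_hom \<Omega> B A h \<longleftrightarrow> (\<forall>b\<in>carrier B. h b \<in> carrier A) \<and> (\<forall>f xs. \<Omega> f = Some (length xs)
     \<longrightarrow> set xs \<subseteq> carrier B \<longrightarrow> h (interp B f xs) = interp A f (map h xs))"

lemma alg_hom_proj: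
  assumes "is_congruence \<Omega> A \<alpha>"
  shows "alg_hom \<Omega> (con_alg A \<alpha>) A fst" "alg_hom \<Omega> (con_alg A \<alpha>) A snd"
  using congruenceD(1)[OF assms] by (auto simp: alg_hom_def con_alg_def)

section \<open>Inverse images of uniformities along homomorphisms\<close>

definition pull :: "('f, 'b) alg \<Rightarrow> ('b \<Rightarrow> 'a) \<Rightarrow> ('a \<times> 'a) set \<Rightarrow> ('b \<times> 'b) set" where
  "pull B h U = {(b, b'). b \<in> carrier B \<and> b' \<in> carrier B \<and> (h b, h b') \<in> U}"

lemma inv_filter_pull: "inv_filter B h \<U> = gen_filter (carrier B) (pull B h ` \<U>)"
  by (simp add: inv_filter_def pull_def)

text \<open>\<open>pull\<close> commutes with intersections, so the inverse images of the members of
  a filter are already a filter base, and generating the filter only adds supersets.\<close>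

lemma inv_filter_iff:
  assumes "is_filter_on S \<U>"
  shows "P \<in> inv_filter B h \<U> \<longleftrightarrow> P \<subseteq> carrier B \<times> carrier B \<and> (\<exists>U\<in>\<U>. pull B h U \<subseteq> P)"
proof
  assume "P \<in> inv_filter B h \<U>"
  then show "P \<subseteq> carrier B \<times> carrier B \<and> (\<exists>U\<in>\<U>. pull B h U \<subseteq> P)"
    unfolding inv_filter_pull
  proof (induction rule: gen_filter_induct)
    case top
    then show ?case using filterD(2)[OF assms] by (auto simp: pull_def)
  next
    case (base U)
    then show ?case by (auto simp: pull_def)
  next
    case (inter P Q)
    then obtain U V where "U \<in> \<U>" "pull B h U \<subseteq> P" "V \<in> \<U>" "pull B h V \<subseteq> Q" by blast
    then show ?case using inter filterD(3)[OF assms] 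
      by (auto simp: pull_def intro!: bexI[of _ "U \<inter> V"])
  qed blast
next
  assume "P \<subseteq> carrier B \<times> carrier B \<and> (\<exists>U\<in>\<U>. pull B h U \<subseteq> P)"
  moreover have "pull B h ` \<U> \<subseteq> gen_filter (carrier B) (pull B h ` \<U>)"
    by (rule gen_filter_superset) (auto simp: pull_def)
  ultimately show "P \<in> inv_filter B h \<U>"
    unfolding inv_filter_pull using filterD(4)[OF gen_filter_filter] by blast
qed

lemma inv_filter_Unif:
  assumes B: "is_algebra \<Omega> B" and h: "alg_hom \<Omega> B A h" and u: "\<U> \<in> carrier (Unif \<Omega> A)"
  shows "inv_filter B h \<U> \<in> carrier (Unif \<Omega> B)"
  unfolding inv_filter_pull
proof (rule gen_filter_Unif[OF B])
  have U: "is_uniformity (carrier A) \<U>" "is_compatible \<Omega> A \<U>" using u by auto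
  note f = filterD[OF uniformityD(1)[OF U(1)]]
  show "pull B h ` \<U> \<subseteq> Pow (carrier B \<times> carrier B)" by (auto simp: pull_def)
  then have sup: "pull B h V \<in> gen_filter (carrier B) (pull B h ` \<U>)" if "V \<in> \<U>" for V
    using gen_filter_superset that by blast
  fix P assume "P \<in> pull B h ` \<U>"
  then obtain U where P: "P = pull B h U" and "U \<in> \<U>" by blast
  note u = uniformityD(2-)[OF U(1) \<open>U \<in> \<U>\<close>]
  show "refl_on (carrier B) P"
    using u(1) h by (auto simp: refl_on_def P pull_def alg_hom_def)
  have "pull B h (U\<inverse>) \<subseteq> P\<inverse>" by (auto simp: P pull_def)
  then show "\<exists>V\<in>gen_filter (carrier B) (pull B h ` \<U>). V \<subseteq> P\<inverse>" using sup u(2) by blast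
  obtain V where V: "V \<in> \<U>" "V O V \<subseteq> U" using u(3) by blast
  then have "pull B h V O pull B h V \<subseteq> P" by (auto simp: P pull_def)
  then show "\<exists>V\<in>gen_filter (carrier B) (pull B h ` \<U>). V O V \<subseteq> P" using sup V by blast
  fix g n assume g: "\<Omega> g = Some n"
  obtain V where V: "V \<in> \<U>" "\<And>xs ys. length xs = n
      \<Longrightarrow> list_all2 (\<lambda>x y. (x, y) \<in> V) xs ys \<Longrightarrow> (interp A g xs, interp A g ys) \<in> U"
    by (rule compatibleE[OF U(2) g \<open>U \<in> \<U>\<close>]) (rule that)
  show "\<exists>V\<in>gen_filter (carrier B) (pull B h ` \<U>). \<forall>xs ys. length xs = n
      \<longrightarrow> list_all2 (\<lambda>x y. (x, y) \<in> V) xs ys \<longrightarrow> (interp B g xs, interp B g ys) \<in> P"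
  proof (intro bexI[OF _ sup[OF V(1)]] allI impI)
    fix xs ys assume l: "length xs = n" "list_all2 (\<lambda>x y. (x, y) \<in> pull B h V) xs ys"
    then have "set xs \<subseteq> carrier B" "set ys \<subseteq> carrier B" "length ys = n"
      "list_all2 (\<lambda>x y. (x, y) \<in> V) (map h xs) (map h ys)"
      by (auto simp: list_all2_conv_all_nth pull_def in_set_conv_nth)
    then show "(interp B g xs, interp B g ys) \<in> P"
      using V(2)[of "map h xs" "map h ys"] l(1) h B g
      by (simp add: P pull_def alg_hom_def is_algebra_def)
  qed
qed

lemma ker_congruence:
  assumes B: "is_algebra \<Omega> B" and h: "alg_hom \<Omega> B A h"
  shows "is_congruence \<Omega> B (ker B h)"
  unfolding is_congruence_def
proof (intro conjI allI impI)
  show "equiv (carrier B) (ker B h)"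
    by (auto simp: ker_def equiv_def refl_on_def sym_def trans_def)
  fix f n xs ys
  assume f: "\<Omega> f = Some n" "length xs = n" "list_all2 (\<lambda>x y. (x, y) \<in> ker B h) xs ys"
  then have "set xs \<subseteq> carrier B" "set ys \<subseteq> carrier B" "length ys = n" "map h xs = map h ys"
    by (auto simp: list_all2_conv_all_nth ker_def in_set_conv_nth intro: nth_equalityI)
  then show "(interp B f xs, interp B f ys) \<in> ker B h"
    using h B f by (simp add: ker_def alg_hom_def is_algebra_def)
qed

text \<open>Compatible uniformities on a homomorphic image correspond to those on the source that
  lie above the kernel; \<open>\<J> \<subseteq> Ug B (ker B h)\<close> says that \<J> is above it.
  Applied to the second projection, this makes the description in \<open>commutator'\<close>
  definite.\<close>

lemma ex1_inv_filter:
  assumes A: "is_algebra \<Omega> A" and B: "is_algebra \<Omega> B" and h: "alg_hom \<Omega> B A h"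
    and surj: "h ` carrier B = carrier A"
    and J: "\<J> \<in> carrier (Unif \<Omega> B)" "\<J> \<subseteq> Ug B (ker B h)"
  shows "\<exists>!\<W>. \<W> \<in> carrier (Unif \<Omega> A) \<and> inv_filter B h \<W> = \<J>"
proof (rule ex_ex1I)
  let ?S = "carrier A"
  have u: "is_uniformity (carrier B) \<J>" "is_compatible \<Omega> B \<J>" using J by auto
  note j = uniformityD[OF u(1)]
  note f = filterD[OF j(1)]
  \<comment> \<open>The quotient uniformity: all relations whose inverse image is in \<J>. The
    direct images \<open>im Q\<close> turn out to be a base of it.\<close>
  define \<W> where "\<W> = {W. W \<subseteq> ?S \<times> ?S \<and> pull B h W \<in> \<J>}"
  define im where "im Q = {(h p, h q) | p q. (p, q) \<in> Q}" for Q
  have pm: "pull B h V \<subseteq> pull B h W" if "V \<subseteq> W" for V W using that by (auto simp: pull_def)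
  have pB: "pull B h V \<subseteq> carrier B \<times> carrier B" for V by (auto simp: pull_def)
  have im: "im Q \<in> \<W>" if "Q \<in> \<J>" for Q
  proof -
    have Q: "Q \<subseteq> carrier B \<times> carrier B" using f(1) that by blast
    then have "Q \<subseteq> pull B h (im Q)" by (auto simp: pull_def im_def)
    then have "pull B h (im Q) \<in> \<J>" using f(4) that pB by blast
    moreover have "im Q \<subseteq> ?S \<times> ?S" using Q h by (auto simp: im_def alg_hom_def)
    ultimately show ?thesis by (simp add: \<W>_def)
  qed
  have kerJ: "ker B h \<subseteq> Q" if "Q \<in> \<J>" for Q using J(2) that by (auto simp: Ug_def)
  \<comment> \<open>Going to the image and back replaces both endpoints by others with the same
    value under \<open>h\<close>. This composes \<open>Q\<close> with the kernel on both sides, and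
    the kernel is contained in \<open>Q\<close>.\<close>
  have im_pull: "(p, q) \<in> Q O Q O Q"
    if pq: "(p, q) \<in> pull B h (im Q)" and Q: "Q \<in> \<J>" for p q Q
  proof -
    obtain p' q' where pq: "(p', q') \<in> Q" "h p = h p'" "h q = h q'" "p \<in> carrier B" "q \<in> carrier B"
      using pq by (auto simp: pull_def im_def)
    then have "(p, p') \<in> ker B h" "(q', q) \<in> ker B h" using f(1)[OF Q] by (auto simp: ker_def)
    then show ?thesis using kerJ[OF Q] pq by blast
  qed
  have "is_filter_on ?S \<W>"
    unfolding is_filter_on_def
  proof (intro conjI ballI allI impI)
    have "pull B h (?S \<times> ?S) = carrier B \<times> carrier B" using h by (auto simp: pull_def alg_hom_def)
    then show "?S \<times> ?S \<in> \<W>" using f(2) by (simp add: \<W>_def)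
    fix U V assume "U \<in> \<W>" "V \<in> \<W>"
    moreover have "pull B h (U \<inter> V) = pull B h U \<inter> pull B h V" by (auto simp: pull_def)
    ultimately show "U \<inter> V \<in> \<W>" using f(3) by (auto simp: \<W>_def)
  next
    fix U V assume "U \<in> \<W>" "U \<subseteq> V \<and> V \<subseteq> ?S \<times> ?S"
    then show "V \<in> \<W>" using f(4)[OF _ pm[of U V] pB[of V]] by (auto simp: \<W>_def)
  next
    show "\<W> \<subseteq> Pow (?S \<times> ?S)" by (auto simp: \<W>_def)
  qed
  moreover have "refl_on ?S W \<and> W\<inverse> \<in> \<W> \<and> (\<exists>V\<in>\<W>. V O V \<subseteq> W)" if W: "W \<in> \<W>" for W
  proof (intro conjI)
    have P: "pull B h W \<in> \<J>" "W \<subseteq> ?S \<times> ?S" using W by (auto simp: \<W>_def)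
    have "(h b, h b) \<in> W" if "b \<in> carrier B" for b
      using j(2)[OF P(1)] that by (auto simp: refl_on_def pull_def)
    then show "refl_on ?S W" unfolding surj[symmetric] by (auto simp: refl_on_def)
    have "pull B h (W\<inverse>) = (pull B h W)\<inverse>" by (auto simp: pull_def)
    then show "W\<inverse> \<in> \<W>" using j(3) P by (auto simp: \<W>_def)
    obtain Q where Q: "Q \<in> \<J>" "Q O Q O Q \<subseteq> pull B h W" using uniformity_comp3[OF u(1) P(1)] by blast
    \<comment> \<open>Two consecutive pairs in the image lift to pairs of \<open>Q\<close> whose
      middle points differ by a kernel pair. That pair lies in \<open>Q\<close> too, whence the
      threefold product.\<close>
    have "im Q O im Q \<subseteq> W"
    proof clarify
      fix a b c assume "(a, b) \<in> im Q" "(b, c) \<in> im Q"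
      then obtain p q p' q' where pq: "(p, q) \<in> Q" "(p', q') \<in> Q" "h q = h p'" "a = h p" "c = h q'"
        by (auto simp: im_def)
      then have "(q, p') \<in> Q" using f(1)[OF Q(1)] kerJ[OF Q(1)] by (auto simp: ker_def)
      then show "(a, c) \<in> W" using pq Q(2) by (auto simp: pull_def)
    qed
    then show "\<exists>V\<in>\<W>. V O V \<subseteq> W" using im[OF Q(1)] by blast
  qed
  moreover have "is_compatible \<Omega> A \<W>"
    unfolding is_compatible_def
  proof (intro allI impI ballI)
    fix g n W assume g: "\<Omega> g = Some n" and "W \<in> \<W>"
    then have P: "pull B h W \<in> \<J>" by (auto simp: \<W>_def)
    obtain Q where Q: "Q \<in> \<J>" "\<And>xs ys. length xs = n
      \<Longrightarrow> list_all2 (\<lambda>x y. (x, y) \<in> Q) xs ys \<Longrightarrow> (interp B g xs, interp B g ys) \<in> pull B h W"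
      by (rule compatibleE[OF u(2) g P]) (rule that)
    show "\<exists>V\<in>\<W>. \<forall>xs ys. length xs = n \<longrightarrow> list_all2 (\<lambda>x y. (x, y) \<in> V) xs ys
      \<longrightarrow> (interp A g xs, interp A g ys) \<in> W"
    proof (intro bexI[OF _ im[OF Q(1)]] allI impI)
      fix xs ys assume l: "length xs = n" "list_all2 (\<lambda>x y. (x, y) \<in> im Q) xs ys"
      \<comment> \<open>The arguments are lifted coordinate by coordinate to pairs related by
        \<open>Q\<close>; the homomorphism carries the value of the operation at the lifts back to
        \<open>A\<close>.\<close>
      have "\<exists>p q. (p, q) \<in> Q \<and> xs ! i = h p \<and> ys ! i = h q" if "i < n" for i
        using l that by (fastforce simp: list_all2_conv_all_nth im_def)
      then obtain p q where pq: "\<And>i. i < n \<Longrightarrow> (p i, q i) \<in> Q \<and> xs ! i = h (p i) \<and> ys ! i = h (q i)"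
        by metis
      let ?p = "map p [0..<n]" let ?q = "map q [0..<n]"
      have "length ys = n" using l by (auto dest: list_all2_lengthD)
      then have eq: "xs = map h ?p" "ys = map h ?q" using l pq by (auto intro: nth_equalityI)
      have "(interp B g ?p, interp B g ?q) \<in> pull B h W"
        using pq by (intro Q(2)) (auto simp: list_all2_conv_all_nth)
      moreover have "set ?p \<subseteq> carrier B" "set ?q \<subseteq> carrier B" using pq f(1)[OF Q(1)] by fastforce+
      then have "h (interp B g ?p) = interp A g xs" "h (interp B g ?q) = interp A g ys"
        unfolding eq using h g unfolding alg_hom_def by auto
      ultimately show "(interp A g xs, interp A g ys) \<in> W" by (simp add: pull_def)
    qed
  qed
  ultimately have WU: "\<W> \<in> carrier (Unif \<Omega> A)" by (simp add: is_uniformity_def)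
  then have fW: "is_filter_on ?S \<W>" by (simp add: is_uniformity_def)
  have "inv_filter B h \<W> = \<J>"
  proof (intro subset_antisym subsetI)
    fix P assume "P \<in> inv_filter B h \<W>"
    then obtain W where "W \<in> \<W>" "pull B h W \<subseteq> P" "P \<subseteq> carrier B \<times> carrier B"
      unfolding inv_filter_iff[OF fW] by blast
    then show "P \<in> \<J>" using f(4)[of "pull B h W" P] by (simp add: \<W>_def)
  next
    fix P assume "P \<in> \<J>"
    then obtain Q where Q: "Q \<in> \<J>" "Q O Q O Q \<subseteq> P" using uniformity_comp3[OF u(1)] by blast
    then have "pull B h (im Q) \<subseteq> P" using im_pull[OF _ Q(1)] by auto
    then show "P \<in> inv_filter B h \<W>"
      unfolding inv_filter_iff[OF fW] using im[OF Q(1)] f(1)[OF \<open>P \<in> \<J>\<close>] by blast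
  qed
  then show "\<exists>\<W>. \<W> \<in> carrier (Unif \<Omega> A) \<and> inv_filter B h \<W> = \<J>" using WU by blast
next
  \<comment> \<open>Uniqueness: since \<open>h\<close> is onto, an inclusion between inverse images
    of relations on \<open>A\<close> implies the inclusion between the relations themselves.\<close>
  have sub: "\<V> \<subseteq> \<W>"
    if v: "\<V> \<in> carrier (Unif \<Omega> A)" and w: "\<W> \<in> carrier (Unif \<Omega> A)"
      and eq: "inv_filter B h \<V> = inv_filter B h \<W>" for \<V> \<W>
  proof
    have fl: "is_filter_on (carrier A) \<V>" "is_filter_on (carrier A) \<W>"
      using v w by (auto simp: is_uniformity_def)
    fix V assume V: "V \<in> \<V>"
    have "pull B h V \<in> inv_filter B h \<V>"
      unfolding inv_filter_iff[OF fl(1)] using V by (auto simp: pull_def)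
    then obtain W where W: "W \<in> \<W>" "pull B h W \<subseteq> pull B h V"
      unfolding eq inv_filter_iff[OF fl(2)] by blast
    have "W \<subseteq> V"
    proof clarify
      fix a b assume ab: "(a, b) \<in> W"
      then have "a \<in> h ` carrier B" "b \<in> h ` carrier B"
        using filterD(1)[OF fl(2) W(1)] surj by auto
      then show "(a, b) \<in> V" using ab W(2) by (auto simp: pull_def)
    qed
    then show "V \<in> \<W>" using filterD(1)[OF fl(1) V] filterD(4)[OF fl(2) W(1)] by blast
  qed
  fix \<V> \<W> assume "\<V> \<in> carrier (Unif \<Omega> A) \<and> inv_filter B h \<V> = \<J>"
    "\<W> \<in> carrier (Unif \<Omega> A) \<and> inv_filter B h \<W> = \<J>"
  then show "\<V> = \<W>" using sub by (intro subset_antisym) auto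
qed

section \<open>The two commutators\<close>

lemma matrices_mono: "U \<subseteq> U' \<Longrightarrow> V \<subseteq> V' \<Longrightarrow> matrices A n n' t U V \<subseteq> matrices A n n' t U' V'"
proof -
  assume UV: "U \<subseteq> U'" "V \<subseteq> V'"
  have "list_all2 (\<lambda>x y. (x, y) \<in> U) a b \<Longrightarrow> list_all2 (\<lambda>x y. (x, y) \<in> U') a b"
    "list_all2 (\<lambda>x y. (x, y) \<in> V) a b \<Longrightarrow> list_all2 (\<lambda>x y. (x, y) \<in> V') a b" for a b
    using UV by (auto elim!: list_all2_mono)
  then show ?thesis unfolding matrices_def by blast
qed

text \<open>For a generator, the witnesses of the uniformity it belongs to are reused. For an
  intersection all three witnesses are intersected, since smaller \<open>U\<close> and
  \<open>V\<close> give fewer matrices. Hence the centralized uniformities are closed under meets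
  and have a least one.\<close>

lemma centralizes_Meet:
  assumes A: "is_algebra \<Omega> A" and fl: "is_filter_on S \<U>" "is_filter_on T \<V>"
    and F: "F \<subseteq> carrier (Unif \<Omega> A)" "\<And>\<W>. \<W> \<in> F \<Longrightarrow> centralizes \<Omega> A \<U> \<V> \<W>"
  shows "centralizes \<Omega> A \<U> \<V> (gen_filter (carrier A) (\<Union>F))"
  unfolding centralizes_def
proof (intro allI impI ballI)
  let ?G = "gen_filter (carrier A) (\<Union>F)"
  have sub: "\<Union>F \<subseteq> Pow (carrier A \<times> carrier A)"
    using F(1) by (fastforce simp: is_uniformity_def is_filter_on_def)
  have G: "is_filter_on (carrier A) ?G" by (rule gen_filter_filter)
  fix n n' t W assume t: "nary_term \<Omega> (n + n') t" and "W \<in> ?G"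
  let ?C = "\<lambda>U V W' W. \<forall>u11 u12 u21 u22. ((u11, u12), (u21, u22)) \<in> matrices A n n' t U V
    \<longrightarrow> (u11, u12) \<in> W' \<longrightarrow> (u21, u22) \<in> W"
  from \<open>W \<in> ?G\<close> show "\<exists>U\<in>\<U>. \<exists>V\<in>\<V>. \<exists>W'\<in>?G. ?C U V W' W"
  proof (induction rule: gen_filter_induct)
    case top
    have *: "u21 \<in> carrier A \<and> u22 \<in> carrier A"
      if "((u11, u12), (u21, u22)) \<in> matrices A n n' t S' T'" for u11 u12 u21 u22 S' T'
    proof -
      have "term_op A t xs \<in> carrier A" if "set xs \<subseteq> carrier A" "length xs = n + n'" for xs
        unfolding term_op_def using t that
        by (intro eval_in_carrier[OF A]) (auto simp: nary_term_def subset_iff)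
      then show ?thesis using that unfolding matrices_def by auto
    qed
    show ?case
      by (rule bexI[OF _ filterD(2)[OF fl(1)]], rule bexI[OF _ filterD(2)[OF fl(2)]],
          rule bexI[OF _ filterD(2)[OF G]]) (use * in blast)
  next
    case (base W)
    then obtain \<W> where "\<W> \<in> F" "W \<in> \<W>" by blast
    then obtain U V W' where "U \<in> \<U>" "V \<in> \<V>" "W' \<in> \<W>" "?C U V W' W"
      using F(2) t unfolding centralizes_def by meson
    moreover have "W' \<in> ?G" using \<open>W' \<in> \<W>\<close> \<open>\<W> \<in> F\<close> gen_filter_superset[OF sub] by blast
    ultimately show ?case by blast
  next
    case (inter W1 W2)
    then obtain U1 V1 W1' U2 V2 W2' where
      1: "U1 \<in> \<U>" "V1 \<in> \<V>" "W1' \<in> ?G" "?C U1 V1 W1' W1" and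
      2: "U2 \<in> \<U>" "V2 \<in> \<V>" "W2' \<in> ?G" "?C U2 V2 W2' W2" by (elim bexE) blast
    have "matrices A n n' t (U1 \<inter> U2) (V1 \<inter> V2) \<subseteq> matrices A n n' t U1 V1"
      "matrices A n n' t (U1 \<inter> U2) (V1 \<inter> V2) \<subseteq> matrices A n n' t U2 V2"
      by (intro matrices_mono; simp)+
    then have "?C (U1 \<inter> U2) (V1 \<inter> V2) (W1' \<inter> W2') (W1 \<inter> W2)" using 1(4) 2(4) by blast
    moreover have "U1 \<inter> U2 \<in> \<U>" "V1 \<inter> V2 \<in> \<V>" "W1' \<inter> W2' \<in> ?G"
      using 1 2 filterD(3)[OF fl(1)] filterD(3)[OF fl(2)] filterD(3)[OF G] by auto
    ultimately show ?case by (elim bexI[rotated])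
  next
    case (mono W1 W2)
    then obtain U V W' where "U \<in> \<U>" "V \<in> \<V>" "W' \<in> ?G" "?C U V W' W1" by (elim bexE)
    moreover have "?C U V W' W2" using \<open>?C U V W' W1\<close> mono by blast
    ultimately show ?case by (elim bexI[rotated])
  qed
qed

text \<open>The meet of all centralized uniformities is itself centralized, so the definite
  description in \<open>commutator\<close> denotes it. By the reversed order, being least means
  containing every other centralized filter.\<close>

lemma commutator_spec:
  assumes A: "is_algebra \<Omega> A" and fl: "is_filter_on S \<U>" "is_filter_on T \<V>"
  shows "commutator \<Omega> A \<U> \<V> \<in> carrier (Unif \<Omega> A)"
    and "centralizes \<Omega> A \<U> \<V> (commutator \<Omega> A \<U> \<V>)"
    and "\<W> \<in> carrier (Unif \<Omega> A) \<Longrightarrow> centralizes \<Omega> A \<U> \<V> \<W> \<Longrightarrow> \<W> \<subseteq> commutator \<Omega> A \<U> \<V>"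
proof -
  let ?F = "{\<W> \<in> carrier (Unif \<Omega> A). centralizes \<Omega> A \<U> \<V> \<W>}"
  let ?G = "gen_filter (carrier A) (\<Union>?F)"
  have F: "?F \<subseteq> carrier (Unif \<Omega> A)" by blast
  have "\<W> \<subseteq> ?G" if "\<W> \<in> ?F" for \<W>
  proof -
    have "\<Union>?F \<subseteq> Pow (carrier A \<times> carrier A)"
      by (fastforce simp: is_uniformity_def is_filter_on_def)
    then show ?thesis using gen_filter_superset that by blast
  qed
  moreover have "?G \<in> ?F"
    using Unif_Meet_carrier[OF A F] centralizes_Meet[OF A fl F] by blast
  ultimately have G: "least (Unif \<Omega> A) ?G ?F"
    unfolding least_def Unif_simps(2) using F by blast
  have "least (Unif \<Omega> A) (commutator \<Omega> A \<U> \<V>) ?F"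
    unfolding commutator_def
  proof (rule theI)
    show "least (Unif \<Omega> A) ?G ?F" by (rule G)
    fix \<W> assume "least (Unif \<Omega> A) \<W> ?F"
    then show "\<W> = ?G" using G unfolding least_def Unif_simps(2) by (intro subset_antisym) blast+
  qed
  then show "commutator \<Omega> A \<U> \<V> \<in> carrier (Unif \<Omega> A)"
    "centralizes \<Omega> A \<U> \<V> (commutator \<Omega> A \<U> \<V>)"
    "\<W> \<in> carrier (Unif \<Omega> A) \<Longrightarrow> centralizes \<Omega> A \<U> \<V> \<W> \<Longrightarrow> \<W> \<subseteq> commutator \<Omega> A \<U> \<V>"
    unfolding least_def Unif_simps(2) by blast+
qed

text \<open>The second claim is the inequality between \<U> and the inverse image of the pushed
  uniformity along the diagonal. It survives the meet in the definition because restriction to the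
  diagonal commutes with intersections and preserves inclusions. The third claim is the universal
  property.\<close>

lemma Delta_unif_spec:
  assumes \<alpha>: "is_congruence \<Omega> A \<alpha>" and u: "\<U> \<in> carrier (Unif \<Omega> A)"
  shows "Delta_unif \<Omega> A \<alpha> \<U> \<in> carrier (Unif \<Omega> (con_alg A \<alpha>))"
    and "D \<in> Delta_unif \<Omega> A \<alpha> \<U> \<Longrightarrow> {(b, c). b \<in> carrier A \<and> c \<in> carrier A \<and> ((b, b), (c, c)) \<in> D} \<in> \<U>"
    and "\<V> \<in> carrier (Unif \<Omega> (con_alg A \<alpha>)) \<Longrightarrow> inv_filter A (\<lambda>a. (a, a)) \<V> \<subseteq> \<U>
      \<Longrightarrow> \<V> \<subseteq> Delta_unif \<Omega> A \<alpha> \<U>"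
proof -
  let ?B = "con_alg A \<alpha>"
  let ?F = "{\<V> \<in> carrier (Unif \<Omega> ?B). inv_filter A (\<lambda>a. (a, a)) \<V> \<subseteq> \<U>}"
  have B: "is_algebra \<Omega> ?B" by (rule con_alg_algebra[OF \<alpha>])
  have F: "?F \<subseteq> carrier (Unif \<Omega> ?B)" by blast
  have eq: "Delta_unif \<Omega> A \<alpha> \<U> = gen_filter (carrier ?B) (\<Union>?F)"
    unfolding Delta_unif_def push_unif_def by (rule Unif_Inf[OF B F])
  show "Delta_unif \<Omega> A \<alpha> \<U> \<in> carrier (Unif \<Omega> ?B)"
    unfolding eq by (rule Unif_Meet_carrier[OF B F])
  have sub: "\<Union>?F \<subseteq> Pow (carrier ?B \<times> carrier ?B)"
    by (fastforce simp: is_uniformity_def is_filter_on_def)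
  show "\<V> \<subseteq> Delta_unif \<Omega> A \<alpha> \<U>"
    if "\<V> \<in> carrier (Unif \<Omega> ?B)" "inv_filter A (\<lambda>a. (a, a)) \<V> \<subseteq> \<U>"
    unfolding eq using gen_filter_superset[OF sub] that by blast
  have fl: "is_filter_on (carrier A) \<U>" using u by (simp add: is_uniformity_def)
  let ?P = "\<lambda>D. {(b, c). b \<in> carrier A \<and> c \<in> carrier A \<and> ((b, b), (c, c)) \<in> D}"
  assume "D \<in> Delta_unif \<Omega> A \<alpha> \<U>"
  then have "D \<in> gen_filter (carrier ?B) (\<Union>?F)" by (simp add: eq)
  then show "?P D \<in> \<U>"
  proof (induction rule: gen_filter_induct)
    case top
    have "?P (carrier ?B \<times> carrier ?B) = carrier A \<times> carrier A"
      using congruenceD(2)[OF \<alpha>] by auto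
    then show ?case using filterD(2)[OF fl] by metis
  next
    case (base D)
    then obtain \<V> where V: "D \<in> \<V>" "\<V> \<in> carrier (Unif \<Omega> ?B)" "inv_filter A (\<lambda>a. (a, a)) \<V> \<subseteq> \<U>"
      by blast
    have "is_filter_on (carrier ?B) \<V>" using V(2) by (simp add: is_uniformity_def)
    then have "pull A (\<lambda>a. (a, a)) D \<in> inv_filter A (\<lambda>a. (a, a)) \<V>"
      using V(1) by (subst inv_filter_iff) (auto simp: pull_def)
    then show ?case using V(3) unfolding pull_def by blast
  next
    case (inter D E)
    have "?P (D \<inter> E) = ?P D \<inter> ?P E" by blast
    then show ?case using filterD(3)[OF fl inter.IH] by metis
  next
    case (mono D E)
    have "?P D \<subseteq> ?P E" "?P E \<subseteq> carrier A \<times> carrier A" using mono.hyps by blast+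
    then show ?case using filterD(4)[OF fl mono.IH] by blast
  qed
qed

section \<open>The commutator defined through A(\<alpha>)\<close>

lemma proj_surj:
  assumes "is_congruence \<Omega> A \<alpha>"
  shows "snd ` carrier (con_alg A \<alpha>) = carrier A"
proof
  show "snd ` carrier (con_alg A \<alpha>) \<subseteq> carrier A" using congruenceD(1)[OF assms] by auto
  show "carrier A \<subseteq> snd ` carrier (con_alg A \<alpha>)"
    using congruenceD(2)[OF assms] by force
qed

text \<open>Unwinds the meet and the join. Meeting with the kernel of \<open>fst\<close> restricts
  an entourage of \<open>Delta_unif\<close> to pairs over a common first coordinate; joining with
  the kernel of \<open>snd\<close> makes only second coordinates matter. Among compatible
  uniformities, \<open>commutator'\<close> is thus the largest filter whose members contain the
  second-coordinate trace of some such restriction.\<close>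

lemma commutator'_spec:
  assumes A: "is_algebra \<Omega> A" and \<alpha>: "is_congruence \<Omega> A \<alpha>" and u: "\<U> \<in> carrier (Unif \<Omega> A)"
  shows "commutator' \<Omega> A \<alpha> \<U> \<in> carrier (Unif \<Omega> A)"
    and "W \<in> commutator' \<Omega> A \<alpha> \<U>
      \<Longrightarrow> \<exists>D\<in>Delta_unif \<Omega> A \<alpha> \<U>. \<forall>x y z. ((x, y), (x, z)) \<in> D \<longrightarrow> (y, z) \<in> W"
    and "\<W> \<in> carrier (Unif \<Omega> A)
      \<Longrightarrow> (\<And>W. W \<in> \<W> \<Longrightarrow> \<exists>D\<in>Delta_unif \<Omega> A \<alpha> \<U>. \<forall>x y z. ((x, y), (x, z)) \<in> D \<longrightarrow> (y, z) \<in> W)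
      \<Longrightarrow> \<W> \<subseteq> commutator' \<Omega> A \<alpha> \<U>"
proof -
  let ?B = "con_alg A \<alpha>" let ?C = "commutator' \<Omega> A \<alpha> \<U>"
  let ?D = "Delta_unif \<Omega> A \<alpha> \<U>"
  let ?K = "Ug ?B (ker ?B fst)" let ?K' = "Ug ?B (ker ?B snd)"
  define M where "M = ?D \<sqinter>\<^bsub>Unif \<Omega> ?B\<^esub> ?K"
  define J where "J = M \<squnion>\<^bsub>Unif \<Omega> ?B\<^esub> ?K'"
  have B: "is_algebra \<Omega> ?B" by (rule con_alg_algebra[OF \<alpha>])
  note hom = alg_hom_proj[OF \<alpha>]
  have K: "?K \<in> carrier (Unif \<Omega> ?B)" "?K' \<in> carrier (Unif \<Omega> ?B)"
    by (rule Ug_Unif[OF B ker_congruence[OF B hom(1)]], rule Ug_Unif[OF B ker_congruence[OF B hom(2)]])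
  note D = Delta_unif_spec[OF \<alpha> u]
  note meet = Unif_meet[OF B D(1) K(1), folded M_def]
  note join = Unif_join[OF B meet(1) K(2), folded J_def]
  have "?C = (THE \<W>. \<W> \<in> carrier (Unif \<Omega> A) \<and> inv_filter ?B snd \<W> = J)"
    unfolding commutator'_def Let_def M_def J_def by (rule refl)
  \<comment> \<open>Being a join with the kernel of \<open>snd\<close>, \<open>J\<close> lies above
    that kernel. Hence it is the inverse image of exactly one uniformity.\<close>
  then have "?C \<in> carrier (Unif \<Omega> A) \<and> inv_filter ?B snd ?C = J"
    using theI'[OF ex1_inv_filter[OF A B hom(2) proj_surj[OF \<alpha>] join(1,3)]] by simp
  then have C: "?C \<in> carrier (Unif \<Omega> A)" and CJ: "inv_filter ?B snd ?C = J" by auto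
  show "?C \<in> carrier (Unif \<Omega> A)" by (rule C)
  have flC: "is_filter_on (carrier A) ?C" using C by (simp add: is_uniformity_def)
  show "\<exists>D\<in>?D. \<forall>x y z. ((x, y), (x, z)) \<in> D \<longrightarrow> (y, z) \<in> W" if W: "W \<in> ?C"
  proof -
    have "pull ?B snd W \<in> inv_filter ?B snd ?C"
      unfolding inv_filter_iff[OF flC] using W by (auto simp: pull_def)
    then have "pull ?B snd W \<in> M" using CJ join(2) by blast
    then obtain D0 V where DV: "D0 \<in> ?D" "V \<in> ?K" "D0 \<inter> V \<subseteq> pull ?B snd W"
      using meet(4) by blast
    have "is_filter_on (carrier ?B) ?D" using D(1) by (simp add: is_uniformity_def)
    then have "D0 \<subseteq> \<alpha> \<times> \<alpha>" using filterD(1)[OF _ DV(1)] by simp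
    then have "(y, z) \<in> W" if "((x, y), (x, z)) \<in> D0" for x y z
    proof -
      have "((x, y), (x, z)) \<in> ker ?B fst" using that \<open>D0 \<subseteq> \<alpha> \<times> \<alpha>\<close> by (auto simp: ker_def)
      then have "((x, y), (x, z)) \<in> pull ?B snd W" using that DV by (auto simp: Ug_def)
      then show ?thesis by (simp add: pull_def)
    qed
    then show ?thesis using DV(1) by blast
  qed
  assume W: "\<W> \<in> carrier (Unif \<Omega> A)"
    and h: "\<And>W. W \<in> \<W> \<Longrightarrow> \<exists>D\<in>?D. \<forall>x y z. ((x, y), (x, z)) \<in> D \<longrightarrow> (y, z) \<in> W"
  have flW: "is_filter_on (carrier A) \<W>" using W by (simp add: is_uniformity_def)
  have flM: "is_filter_on (carrier ?B) M" using meet(1) by (simp add: is_uniformity_def)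
  have uW: "refl_on (carrier A) V" if "V \<in> \<W>" for V
    using W that by (simp add: is_uniformity_def)
  have kerM: "ker ?B fst \<in> M"
    by (rule subsetD[OF meet(3)]) (auto simp: Ug_def ker_def)
  \<comment> \<open>\<open>J\<close> is the largest compatible uniformity contained as a filter in
    both \<open>M\<close> and \<open>?K'\<close>, so the inverse image of \<W> is compared with
    these two separately.\<close>
  have "inv_filter ?B snd \<W> \<subseteq> M"
  proof
    fix P assume "P \<in> inv_filter ?B snd \<W>"
    then obtain V where V: "V \<in> \<W>" "pull ?B snd V \<subseteq> P" "P \<subseteq> carrier ?B \<times> carrier ?B"
      unfolding inv_filter_iff[OF flW] by blast
    obtain D0 where D0: "D0 \<in> ?D" "\<And>x y z. ((x, y), (x, z)) \<in> D0 \<Longrightarrow> (y, z) \<in> V"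
      using h[OF V(1)] by blast
    have "D0 \<inter> ker ?B fst \<subseteq> P"
      using D0(2) V(2) by (auto simp: ker_def pull_def)
    moreover have "D0 \<inter> ker ?B fst \<in> M" using filterD(3)[OF flM _ kerM] D0(1) meet(2) by blast
    ultimately show "P \<in> M" using filterD(4)[OF flM] V(3) by blast
  qed
  moreover have "inv_filter ?B snd \<W> \<subseteq> ?K'"
  proof
    fix P assume "P \<in> inv_filter ?B snd \<W>"
    then obtain V where V: "V \<in> \<W>" "pull ?B snd V \<subseteq> P" "P \<subseteq> carrier ?B \<times> carrier ?B"
      unfolding inv_filter_iff[OF flW] by blast
    have "ker ?B snd \<subseteq> pull ?B snd V"
      using uW[OF V(1)] congruenceD(1)[OF \<alpha>] by (auto simp: ker_def pull_def refl_on_def)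
    then show "P \<in> ?K'" using V by (auto simp: Ug_def)
  qed
  ultimately have "inv_filter ?B snd \<W> \<subseteq> inv_filter ?B snd ?C"
    using join(4)[OF inv_filter_Unif[OF B hom(2) W]] CJ by blast
  then show "\<W> \<subseteq> ?C"
  proof (rule_tac subsetI)
    fix V assume sub: "inv_filter ?B snd \<W> \<subseteq> inv_filter ?B snd ?C" and V: "V \<in> \<W>"
    have "pull ?B snd V \<in> inv_filter ?B snd \<W>"
      unfolding inv_filter_iff[OF flW] using V by (auto simp: pull_def)
    from subsetD[OF sub this] obtain V' where V': "V' \<in> ?C" "pull ?B snd V' \<subseteq> pull ?B snd V"
      unfolding inv_filter_iff[OF flC] by blast
    \<comment> \<open>Diagonal elements lift any pair of elements of \<open>A\<close>, so that the
      inclusion can be read off from the inverse images.\<close>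
    have "V' \<subseteq> V"
    proof clarify
      fix a b assume ab: "(a, b) \<in> V'"
      then have "(a, a) \<in> \<alpha>" "(b, b) \<in> \<alpha>"
        using filterD(1)[OF flC V'(1)] congruenceD(2)[OF \<alpha>] by auto
      then have "((a, a), (b, b)) \<in> pull ?B snd V'" using ab by (simp add: pull_def)
      then have "((a, a), (b, b)) \<in> pull ?B snd V" using V'(2) by blast
      then show "(a, b) \<in> V" by (simp add: pull_def)
    qed
    then show "V \<in> ?C" using filterD(1)[OF flW V] filterD(4)[OF flC V'(1)] by blast
  qed
qed

section \<open>Day terms\<close>

text \<open>The relatively free algebra on four generators is realised as the algebra of quaternary term
  functions. The terms below form a chain from \<open>x\<close> to \<open>w\<close> in that algebra: \<open>x\<close> and \<open>w\<close> are
  congruent modulo \<open>x = w, y = z\<close> and modulo the join of \<open>x = y, z = w\<close> with \<open>y = z\<close>.\<close>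

lemma Day_terms:
  fixes A :: "('f, 'a) alg"
  assumes E: "cm_variety \<Omega> E" and A: "is_algebra \<Omega> A" "models A E"
  obtains n and m :: "nat \<Rightarrow> ('f, nat) trm" where
    "\<And>i. i \<le> n \<Longrightarrow> wf_trm \<Omega> (m i) \<and> vars (m i) \<subseteq> {..<4}"
    "\<And>\<rho>. range \<rho> \<subseteq> carrier A \<Longrightarrow> eval A \<rho> (m 0) = \<rho> 0"
    "\<And>\<rho>. range \<rho> \<subseteq> carrier A \<Longrightarrow> eval A \<rho> (m n) = \<rho> 3"
    "\<And>i \<rho>. i \<le> n \<Longrightarrow> range \<rho> \<subseteq> carrier A \<Longrightarrow> \<rho> 0 = \<rho> 3 \<Longrightarrow> \<rho> 1 = \<rho> 2 \<Longrightarrow> eval A \<rho> (m i) = \<rho> 0"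
    "\<And>i. i < n \<Longrightarrow>
       (\<forall>\<rho>. range \<rho> \<subseteq> carrier A \<longrightarrow> \<rho> 0 = \<rho> 1 \<longrightarrow> \<rho> 2 = \<rho> 3 \<longrightarrow> eval A \<rho> (m i) = eval A \<rho> (m (Suc i))) \<or>
       (\<forall>\<rho>. range \<rho> \<subseteq> carrier A \<longrightarrow> \<rho> 1 = \<rho> 2 \<longrightarrow> eval A \<rho> (m i) = eval A \<rho> (m (Suc i)))"
proof -
  let ?R = "\<lambda>\<rho> :: nat \<Rightarrow> 'a. range \<rho> \<subseteq> carrier A"
  \<comment> \<open>Term functions are given the value \<open>undefined\<close> at assignments that
    leave the carrier, so that two of them are equal as HOL functions as soon as they agree on
    \<open>A\<close>.\<close>
  define T where "T t = (\<lambda>\<rho>. if ?R \<rho> then eval A \<rho> t else undefined)" for t :: "('f, nat) trm"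
  define F :: "('f, (nat \<Rightarrow> 'a) \<Rightarrow> 'a) alg" where
    "F = \<lparr>carrier = T ` {t. wf_trm \<Omega> t \<and> vars t \<subseteq> {..<4}},
      interp = (\<lambda>f xs \<rho>. if ?R \<rho> then interp A f (map (\<lambda>x. x \<rho>) xs) else undefined)\<rparr>"
  have T: "T t \<rho> = eval A \<rho> t" if "?R \<rho>" for t \<rho> using that by (simp add: T_def)
  have F_interp: "interp F f xs \<rho> = interp A f (map (\<lambda>x. x \<rho>) xs)" if "?R \<rho>" for f xs \<rho>
    using that by (simp add: F_def)
  have F_alg: "is_algebra \<Omega> F"
    unfolding is_algebra_def
  proof (intro allI impI)
    fix f n xs assume f: "\<Omega> f = Some n" "length xs = n" "set xs \<subseteq> carrier F"
    then have "\<forall>x\<in>set xs. \<exists>t. wf_trm \<Omega> t \<and> vars t \<subseteq> {..<4} \<and> x = T t" by (auto simp: F_def)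
    from bchoice[OF this] obtain t
      where t: "\<And>x. x \<in> set xs \<Longrightarrow> wf_trm \<Omega> (t x) \<and> vars (t x) \<subseteq> {..<4} \<and> x = T (t x)"
      by blast
    have "interp F f xs = T (App f (map t xs))"
    proof
      fix \<rho>
      have "interp A f (map (\<lambda>x. x \<rho>) xs) = interp A f (map (\<lambda>x. eval A \<rho> (t x)) xs)" if "?R \<rho>"
      proof -
        have "x \<rho> = eval A \<rho> (t x)" if "x \<in> set xs" for x
          using t[OF that] T[OF \<open>?R \<rho>\<close>, of "t x"] by metis
        then show ?thesis by (intro arg_cong[of _ _ "interp A f"] map_cong refl)
      qed
      then show "interp F f xs \<rho> = T (App f (map t xs)) \<rho>" by (simp add: F_def T_def o_def)
    qed
    moreover have "wf_trm \<Omega> (App f (map t xs))" "vars (App f (map t xs)) \<subseteq> {..<4}"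
      using t f by (auto simp: list_all_iff)
    ultimately show "interp F f xs \<in> carrier F" by (auto simp: F_def)
  qed
  have evF: "eval F \<sigma> t \<rho> = eval A (\<lambda>i. \<sigma> i \<rho>) t" if "?R \<rho>" for \<sigma> \<rho> and t :: "('f, nat) trm"
    using that by (induction t) (auto simp: F_interp o_def cong: map_cong)
  have F_out: "x \<rho> = undefined" if "x \<in> carrier F" "\<not> ?R \<rho>" for x \<rho>
  proof -
    obtain t where "x = T t" using \<open>x \<in> carrier F\<close> by (auto simp: F_def)
    then show ?thesis using that(2) by (simp only: T_def if_False)
  qed
  have F_val: "x \<rho> \<in> carrier A" if "x \<in> carrier F" "?R \<rho>" for x \<rho>
  proof -
    obtain t where "x = T t" "wf_trm \<Omega> t" using \<open>x \<in> carrier F\<close> by (auto simp: F_def)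
    then show ?thesis using T[OF that(2)] eval_carrier[OF A(1) that(2)] by simp
  qed
  have F_models: "models F E"
    unfolding models_def
  proof clarify
    fix s t and \<sigma> :: "nat \<Rightarrow> (nat \<Rightarrow> 'a) \<Rightarrow> 'a"
    assume st: "(s, t) \<in> E" and \<sigma>: "range \<sigma> \<subseteq> carrier F"
    have wf: "wf_trm \<Omega> s" "wf_trm \<Omega> t" using E st by (auto simp: cm_variety_def)
    show "eval F \<sigma> s = eval F \<sigma> t"
    proof
      fix \<rho>
      show "eval F \<sigma> s \<rho> = eval F \<sigma> t \<rho>"
      proof (cases "?R \<rho>")
        case True
        then have "range (\<lambda>i. \<sigma> i \<rho>) \<subseteq> carrier A" using \<sigma> F_val by blast
        then have "eval A (\<lambda>i. \<sigma> i \<rho>) s = eval A (\<lambda>i. \<sigma> i \<rho>) t"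
          using A(2) st unfolding models_def by blast
        then show ?thesis using True by (simp add: evF)
      next
        case False
        then show ?thesis using F_out eval_carrier[OF F_alg \<sigma>] wf by metis
      qed
    qed
  qed
  \<comment> \<open>Two term functions are identified when they agree at all assignments satisfying
    \<open>P\<close>. A stronger condition gives a larger congruence, which is why
    \<open>?\<gamma>\<close> is below \<open>?\<beta>\<close>.\<close>
  define C where "C P = {(x, y). x \<in> carrier F \<and> y \<in> carrier F \<and> (\<forall>\<rho>. ?R \<rho> \<longrightarrow> P \<rho> \<longrightarrow> x \<rho> = y \<rho>)}" for P
  have C: "is_congruence \<Omega> F (C P)" for P
    unfolding is_congruence_def
  proof (intro conjI allI impI)
    show "equiv (carrier F) (C P)"
      by (auto simp: C_def equiv_def refl_on_def sym_def trans_def)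
    fix f n xs ys assume f: "\<Omega> f = Some n" "length xs = n" "list_all2 (\<lambda>x y. (x, y) \<in> C P) xs ys"
    then have F: "set xs \<subseteq> carrier F" "set ys \<subseteq> carrier F" "length ys = n"
      by (auto simp: list_all2_conv_all_nth C_def in_set_conv_nth)
    then have "interp F f xs \<in> carrier F" "interp F f ys \<in> carrier F"
      using F_alg f unfolding is_algebra_def by auto
    moreover have "interp F f xs \<rho> = interp F f ys \<rho>" if "?R \<rho>" "P \<rho>" for \<rho>
    proof -
      have "map (\<lambda>x. x \<rho>) xs = map (\<lambda>x. x \<rho>) ys"
        using f F that by (auto simp: list_all2_conv_all_nth C_def intro!: nth_equalityI)
      then show ?thesis using F_interp[OF that(1)] by metis
    qed
    ultimately show "(interp F f xs, interp F f ys) \<in> C P" by (simp add: C_def)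
  qed
  let ?\<alpha> = "C (\<lambda>\<rho>. \<rho> 0 = \<rho> 1 \<and> \<rho> 2 = \<rho> 3)" let ?\<beta> = "C (\<lambda>\<rho>. \<rho> 0 = \<rho> 3 \<and> \<rho> 1 = \<rho> 2)"
  let ?\<gamma> = "C (\<lambda>\<rho>. \<rho> 1 = \<rho> 2)"
  have \<gamma>\<beta>: "?\<gamma> \<subseteq> ?\<beta>" by (auto simp: C_def)
  have "modular_lattice (Con \<Omega> F)" by (rule cm_varietyD[OF E F_alg F_models])
  then have "(?\<gamma> \<squnion>\<^bsub>Con \<Omega> F\<^esub> ?\<alpha>) \<sqinter>\<^bsub>Con \<Omega> F\<^esub> ?\<beta> = ?\<gamma> \<squnion>\<^bsub>Con \<Omega> F\<^esub> (?\<alpha> \<sqinter>\<^bsub>Con \<Omega> F\<^esub> ?\<beta>)"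
    unfolding modular_lattice_def using C \<gamma>\<beta> by simp
  then have mod: "(?\<gamma> \<union> ?\<alpha>)\<^sup>+ \<inter> ?\<beta> = (?\<gamma> \<union> ?\<alpha> \<inter> ?\<beta>)\<^sup>+"
    using C F_alg by (simp add: join_Con meet_Con is_congruence_join is_congruence_Int)
  let ?v = "\<lambda>i. T (Var i)"
  have v: "?v i \<in> carrier F" if "i < 4" for i using that by (auto simp: F_def)
  \<comment> \<open>The four generators x, y, z, w are linked by \<open>?\<alpha>\<close>,
    \<open>?\<gamma>\<close>, \<open>?\<alpha>\<close> in turn, while x and w are directly related
    by \<open>?\<beta>\<close>. The modular law turns this into a chain with links in
    \<open>?\<gamma>\<close> or in \<open>?\<alpha> \<inter> ?\<beta>\<close>; its members are the
    Day terms.\<close>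
  have "(?v 0, ?v 1) \<in> ?\<gamma> \<union> ?\<alpha>" "(?v 1, ?v 2) \<in> ?\<gamma> \<union> ?\<alpha>" "(?v 2, ?v 3) \<in> ?\<gamma> \<union> ?\<alpha>"
    using v by (auto simp: C_def T)
  then have "(?v 0, ?v 3) \<in> (?\<gamma> \<union> ?\<alpha>)\<^sup>+" by (meson trancl.r_into_trancl trancl_into_trancl)
  moreover have "(?v 0, ?v 3) \<in> ?\<beta>" using v by (auto simp: C_def T)
  ultimately have "(?v 0, ?v 3) \<in> (?\<gamma> \<union> ?\<alpha> \<inter> ?\<beta>)\<^sup>+" using mod by blast
  then obtain n where "(?v 0, ?v 3) \<in> (?\<gamma> \<union> ?\<alpha> \<inter> ?\<beta>) ^^ n" using trancl_power by blast
  then obtain p where p: "p 0 = ?v 0" "p n = ?v 3"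
    and step: "\<And>i. i < n \<Longrightarrow> (p i, p (Suc i)) \<in> ?\<gamma> \<union> ?\<alpha> \<inter> ?\<beta>"
    unfolding relpow_fun_conv by blast
  have pF: "p i \<in> carrier F" if "i \<le> n" for i
    using that step[of i] p(2) v[of 3] by (cases "i = n") (auto simp: C_def)
  then have "\<forall>i. \<exists>t. i \<le> n \<longrightarrow> wf_trm \<Omega> t \<and> vars t \<subseteq> {..<4} \<and> p i = T t"
    by (fastforce simp: F_def)
  then obtain m where m: "\<And>i. i \<le> n \<Longrightarrow> wf_trm \<Omega> (m i) \<and> vars (m i) \<subseteq> {..<4} \<and> p i = T (m i)"
    by metis
  have ev: "eval A \<rho> (m i) = p i \<rho>" if "i \<le> n" "?R \<rho>" for i \<rho> using m[OF that(1)] T[OF that(2)] by simp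
  \<comment> \<open>Both kinds of link lie in \<open>?\<beta>\<close>, so the whole chain stays
    \<open>?\<beta>\<close>-related to its first member, the generator x.\<close>
  have p\<beta>: "p i \<rho> = \<rho> 0" if "i \<le> n" "?R \<rho>" "\<rho> 0 = \<rho> 3" "\<rho> 1 = \<rho> 2" for i \<rho>
    using that(1)
  proof (induction i)
    case 0
    then show ?case using p(1) T that by simp
  next
    case (Suc i)
    have "(p i, p (Suc i)) \<in> ?\<beta>" using step[of i] Suc.prems \<gamma>\<beta> by auto
    then have "p i \<rho> = p (Suc i) \<rho>" using that by (auto simp: C_def)
    then show ?case using Suc by simp
  qed
  show thesis
  proof (rule that[of n m])
    show "wf_trm \<Omega> (m i) \<and> vars (m i) \<subseteq> {..<4}" if "i \<le> n" for i using m that by blast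
    show "eval A \<rho> (m 0) = \<rho> 0" if "?R \<rho>" for \<rho> using ev[of 0] p(1) T that by simp
    show "eval A \<rho> (m n) = \<rho> 3" if "?R \<rho>" for \<rho> using ev[of n] p(2) T that by simp
    show "eval A \<rho> (m i) = \<rho> 0" if "i \<le> n" "?R \<rho>" "\<rho> 0 = \<rho> 3" "\<rho> 1 = \<rho> 2" for i \<rho>
      using ev[OF that(1,2)] p\<beta>[OF that] by simp
    show "(\<forall>\<rho>. ?R \<rho> \<longrightarrow> \<rho> 0 = \<rho> 1 \<longrightarrow> \<rho> 2 = \<rho> 3 \<longrightarrow> eval A \<rho> (m i) = eval A \<rho> (m (Suc i))) \<or>
       (\<forall>\<rho>. ?R \<rho> \<longrightarrow> \<rho> 1 = \<rho> 2 \<longrightarrow> eval A \<rho> (m i) = eval A \<rho> (m (Suc i)))" if "i < n" for i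
      using step[OF that] ev[of i] ev[of "Suc i"] that by (auto simp: C_def)
  qed
qed

section \<open>The commutator is below its variant\<close>

text \<open>Each column of a matrix is an element of A(\<alpha>), namely the value of
  \<open>t\<close> there at the pairs from \<open>a\<close> and \<open>a'\<close> and the diagonal
  pairs from \<open>b\<close> or \<open>c\<close>. The first kind of argument is the same in both
  columns; the second kind moves along the diagonal, where the trace of an entourage belongs to
  \<U>.\<close>

lemma Delta_columns:
  assumes \<alpha>: "is_congruence \<Omega> A \<alpha>" and u: "\<U> \<in> carrier (Unif \<Omega> A)"
    and t: "nary_term \<Omega> (n + n') t" and D: "D \<in> Delta_unif \<Omega> A \<alpha> \<U>"
  shows "\<exists>V\<in>\<U>. \<forall>a a' b c. length a = n \<longrightarrow> length b = n' \<longrightarrow> list_all2 (\<lambda>x y. (x, y) \<in> \<alpha>) a a' \<longrightarrow>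
    list_all2 (\<lambda>x y. (x, y) \<in> V) b c \<longrightarrow>
    ((term_op A t (a @ b), term_op A t (a' @ b)), (term_op A t (a @ c), term_op A t (a' @ c))) \<in> D"
proof -
  let ?B = "con_alg A \<alpha>"
  note spec = Delta_unif_spec[OF \<alpha> u]
  have wf: "wf_trm \<Omega> t" "vars t \<subseteq> {..<n + n'}" using t by (auto simp: nary_term_def)
  obtain D' where D': "D' \<in> Delta_unif \<Omega> A \<alpha> \<U>"
    "\<And>\<rho> \<sigma>. \<forall>v\<in>vars t. (\<rho> v, \<sigma> v) \<in> D' \<Longrightarrow> (eval ?B \<rho> t, eval ?B \<sigma> t) \<in> D"
    using compatible_eval[OF con_alg_algebra[OF \<alpha>] spec(1) wf(1) D] by blast
  have refl: "refl_on \<alpha> D'" using spec(1) D'(1) by (simp add: is_uniformity_def)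
  let ?V = "{(b, c). b \<in> carrier A \<and> c \<in> carrier A \<and> ((b, b), (c, c)) \<in> D'}"
  show ?thesis
  proof (intro bexI[OF _ spec(2)[OF D'(1)]] allI impI)
    fix a a' b c assume h: "length a = n" "length b = n'" "list_all2 (\<lambda>x y. (x, y) \<in> \<alpha>) a a'"
      "list_all2 (\<lambda>x y. (x, y) \<in> ?V) b c"
    then have len: "length a' = n" "length c = n'" by (auto dest: list_all2_lengthD)
    \<comment> \<open>Positions below \<open>n\<close> hold the same pair on both sides and are
      covered by reflexivity; the later ones hold diagonal pairs, shifted by
      \<open>n\<close>.\<close>
    have "(((a @ b) ! v, (a' @ b) ! v), ((a @ c) ! v, (a' @ c) ! v)) \<in> D'" if "v \<in> vars t" for v
    proof (cases "v < n")
      case True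
      then have "(a ! v, a' ! v) \<in> \<alpha>" using h by (simp add: list_all2_conv_all_nth)
      then show ?thesis using refl True h len by (simp add: nth_append refl_on_def)
    next
      case False
      then have "v - n < n'" using that wf(2) by auto
      then have "((b ! (v - n), b ! (v - n)), (c ! (v - n), c ! (v - n))) \<in> D'"
        using h by (auto simp: list_all2_conv_all_nth)
      then show ?thesis using False h len by (simp add: nth_append)
    qed
    then show "((term_op A t (a @ b), term_op A t (a' @ b)), (term_op A t (a @ c), term_op A t (a' @ c))) \<in> D"
      using D'(2)[of "\<lambda>v. ((a @ b) ! v, (a' @ b) ! v)" "\<lambda>v. ((a @ c) ! v, (a' @ c) ! v)"]
      by (simp add: eval_con_alg term_op_def)
  qed
qed

text \<open>All indices from 3 on yield \<open>w\<close>, so the entire range lies in the carrier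
  once the four arguments do, as the identities of the Day terms demand of an assignment.\<close>

definition quad :: "'b \<Rightarrow> 'b \<Rightarrow> 'b \<Rightarrow> 'b \<Rightarrow> nat \<Rightarrow> 'b" where
  "quad x y z w v = (if v = 0 then x else if v = 1 then y else if v = 2 then z else w)"

lemma quad_simps [simp]:
  "quad x y z w 0 = x" "quad x y z w (Suc 0) = y" "quad x y z w 1 = y" "quad x y z w 2 = z" "quad x y z w 3 = w"
  by (simp_all add: quad_def)

lemma eval_con_alg_quad: "eval (con_alg A \<alpha>) (quad (x, x') (y, y') (z, z') (w, w')) t
  = (eval A (quad x y z w) t, eval A (quad x' y' z' w') t)"
proof -
  have "(\<lambda>v. fst (quad (x, x') (y, y') (z, z') (w, w') v)) = quad x y z w"
    "(\<lambda>v. snd (quad (x, x') (y, y') (z, z') (w, w') v)) = quad x' y' z' w'"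
    by (auto simp: quad_def)
  then show ?thesis by (simp add: eval_con_alg)
qed

text \<open>One halving per link: \<open>U'\<close> absorbs the last step, and the induction
  hypothesis for \<open>U'\<close> absorbs the others. A chain without links needs only reflexivity,
  hence the condition on \<open>g 0\<close>.\<close>

lemma uniformity_chain:
  assumes u: "is_uniformity S \<U>" and "U \<in> \<U>"
  shows "\<exists>V\<in>\<U>. \<forall>g. g 0 \<in> S \<longrightarrow> (\<forall>i<n. (g i, g (Suc i)) \<in> V) \<longrightarrow> (g 0, g n) \<in> U"
  using assms(2)
proof (induction n arbitrary: U)
  case 0
  have "refl_on S U" by (rule uniformityD(2)[OF u 0])
  then show ?case using 0 by (auto simp: refl_on_def)
next
  case (Suc n)
  obtain U' where U': "U' \<in> \<U>" "U' O U' \<subseteq> U" using uniformityD(4)[OF u Suc.prems] by blast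
  obtain V where V: "V \<in> \<U>" "\<And>g. g 0 \<in> S \<Longrightarrow> \<forall>i<n. (g i, g (Suc i)) \<in> V \<Longrightarrow> (g 0, g n) \<in> U'"
    using Suc.IH[OF U'(1)] by blast
  have "V \<inter> U' \<in> \<U>" by (rule filterD(3)[OF uniformityD(1)[OF u] V(1) U'(1)])
  moreover have "(g 0, g (Suc n)) \<in> U" if "g 0 \<in> S" "\<forall>i<Suc n. (g i, g (Suc i)) \<in> V \<inter> U'" for g
  proof -
    have "(g 0, g n) \<in> U'" using V(2)[of g] that by auto
    moreover have "(g n, g (Suc n)) \<in> U'" using that by auto
    ultimately show ?thesis using U'(2) by blast
  qed
  ultimately show ?case by blast
qed

lemma uniformity_sym_comp:
  assumes u: "is_uniformity S \<U>" and "U \<in> \<U>"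
  obtains V where "V \<in> \<U>" "V\<inverse> = V" "V O V \<subseteq> U"
proof -
  obtain V where V: "V \<in> \<U>" "V O V \<subseteq> U" using uniformityD(4)[OF u assms(2)] by blast
  show thesis
  proof (rule that)
    show "V \<inter> V\<inverse> \<in> \<U>" by (rule filterD(3)[OF uniformityD(1)[OF u] V(1) uniformityD(3)[OF u V(1)]])
    show "(V \<inter> V\<inverse>) O (V \<inter> V\<inverse>) \<subseteq> U" using V(2) by blast
  qed auto
qed

text \<open>The two sides are the second coordinates of elements of \<open>A(\<alpha>)\<close> with the same first coordinate,
  and replacing \<open>c\<close> by \<open>b\<close> moves both of these to the diagonal element over \<open>u21\<close>.\<close>

lemma commutator'_quaternary:
  assumes A: "is_algebra \<Omega> A" and \<alpha>: "is_congruence \<Omega> A \<alpha>" and u: "\<U> \<in> carrier (Unif \<Omega> A)"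
    and t: "nary_term \<Omega> (n + n') t" and m: "wf_trm \<Omega> m"
    and m_id: "\<And>x y. x \<in> carrier A \<Longrightarrow> y \<in> carrier A \<Longrightarrow> eval A (quad x y y x) m = x"
    and W: "W \<in> commutator' \<Omega> A \<alpha> \<U>"
  shows "\<exists>V\<in>\<U>. \<forall>u11 u12 u21 u22. ((u11, u12), (u21, u22)) \<in> matrices A n n' t \<alpha> V \<longrightarrow>
    (eval A (quad u21 u21 u22 u22) m, eval A (quad u21 u11 u12 u22) m) \<in> W"
proof -
  let ?B = "con_alg A \<alpha>" let ?D = "Delta_unif \<Omega> A \<alpha> \<U>"
  note spec = Delta_unif_spec[OF \<alpha> u]
  have B: "is_algebra \<Omega> ?B" by (rule con_alg_algebra[OF \<alpha>])
  have uD: "is_uniformity \<alpha> ?D" using spec(1) by simp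
  obtain D where D: "D \<in> ?D" "\<And>x y z. ((x, y), (x, z)) \<in> D \<Longrightarrow> (y, z) \<in> W"
    using commutator'_spec(2)[OF A \<alpha> u W] by blast
  obtain D1 where D1: "D1 \<in> ?D" "D1\<inverse> = D1" "D1 O D1 \<subseteq> D"
    by (rule uniformity_sym_comp[OF uD D(1)])
  obtain D2 where D2: "D2 \<in> ?D"
    "\<And>\<rho> \<sigma>. \<forall>v\<in>vars m. (\<rho> v, \<sigma> v) \<in> D2 \<Longrightarrow> (eval ?B \<rho> m, eval ?B \<sigma> m) \<in> D1"
    using compatible_eval[OF B spec(1) m D1(1)] by blast
  have refl: "(p, p) \<in> D2" if "p \<in> \<alpha>" for p
    using uniformityD(2)[OF uD D2(1)] that by (simp add: refl_on_def)
  obtain V where V: "V \<in> \<U>" "\<And>a a' b c. length a = n \<Longrightarrow> length b = n' \<Longrightarrow>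
    list_all2 (\<lambda>x y. (x, y) \<in> \<alpha>) a a' \<Longrightarrow> list_all2 (\<lambda>x y. (x, y) \<in> V) b c \<Longrightarrow>
    ((term_op A t (a @ b), term_op A t (a' @ b)), (term_op A t (a @ c), term_op A t (a' @ c))) \<in> D2"
    using Delta_columns[OF \<alpha> u t D2(1)] by blast
  have D2\<alpha>: "D2 \<subseteq> \<alpha> \<times> \<alpha>" by (rule filterD(1)[OF uniformityD(1)[OF uD] D2(1)])
  show ?thesis
  proof (intro bexI[OF _ V(1)] allI impI)
    fix u11 u12 u21 u22 assume "((u11, u12), (u21, u22)) \<in> matrices A n n' t \<alpha> V"
    then obtain a a' b c where eq: "u11 = term_op A t (a @ b)" "u12 = term_op A t (a @ c)"
        "u21 = term_op A t (a' @ b)" "u22 = term_op A t (a' @ c)"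
      and l: "length a = n" "length a' = n" "length b = n'" "set a' \<subseteq> carrier A"
      and h: "list_all2 (\<lambda>x y. (x, y) \<in> \<alpha>) a a'" "list_all2 (\<lambda>x y. (x, y) \<in> V) b c"
      unfolding matrices_def by blast
    have h': "list_all2 (\<lambda>x y. (x, y) \<in> \<alpha>) a' a" "list_all2 (\<lambda>x y. (x, y) \<in> \<alpha>) a' a'"
      using h(1) congruenceD(2,3)[OF \<alpha>] l by (auto simp: list_all2_conv_all_nth subset_iff)
    \<comment> \<open>The rows are used in reverse order: the lower row supplies the first
      coordinates, and the second coordinates come from the lower row again or from the upper
      one.\<close>
    have col: "((u21, u21), (u22, u22)) \<in> D2" "((u21, u11), (u22, u12)) \<in> D2"
      using V(2)[OF l(2,3) h'(2) h(2)] V(2)[OF l(2,3) h'(1) h(2)] by (auto simp: eq)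
    have car: "u21 \<in> carrier A" "u11 \<in> carrier A"
      using col D2\<alpha> congruenceD(1)[OF \<alpha>] by auto
    have r: "((u21, u21), (u21, u21)) \<in> D2" "((u21, u11), (u21, u11)) \<in> D2"
      using refl col D2\<alpha> by auto
    let ?x = "eval A (quad u21 u21 u22 u22) m" and ?y = "eval A (quad u21 u11 u12 u22) m"
    have "(eval ?B (quad (u21, u21) (u21, u21) (u21, u21) (u21, u21)) m,
      eval ?B (quad (u21, u21) (u21, u21) (u22, u22) (u22, u22)) m) \<in> D1"
      by (rule D2(2)) (use col r in \<open>simp add: quad_def\<close>)
    then have 1: "((u21, u21), (?x, ?x)) \<in> D1" using m_id car by (simp add: eval_con_alg_quad)
    \<comment> \<open>With the columns for \<open>c\<close> replaced by those for \<open>b\<close>,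
      the second coordinate is m(u21, u11, u11, u21). By \<open>m_id\<close> it collapses to
      \<open>u21\<close>, just as the first coordinate does.\<close>
    have "(eval ?B (quad (u21, u21) (u21, u11) (u21, u11) (u21, u21)) m,
      eval ?B (quad (u21, u21) (u21, u11) (u22, u12) (u22, u22)) m) \<in> D1"
      by (rule D2(2)) (use col r in \<open>simp add: quad_def\<close>)
    then have 2: "((u21, u21), (?x, ?y)) \<in> D1" using m_id car by (simp add: eval_con_alg_quad)
    have "((?x, ?x), (u21, u21)) \<in> D1" using 1 D1(2) by blast
    then have "((?x, ?x), (?x, ?y)) \<in> D" using 2 D1(3) by blast
    then show "(?x, ?y) \<in> W" by (rule D(2))
  qed
qed

text \<open>All entourages are fixed before the matrix: \<open>W1\<close> allows \<open>N\<close>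
  links inside \<open>W\<close>, \<open>W2\<close> is half of \<open>W1\<close>, and
  \<open>V\<close> and \<open>W'\<close> serve all terms \<open>m i\<close> with
  \<open>i \<le> N\<close> simultaneously. On the left, \<alpha> itself is taken from its
  filter.\<close>

lemma commutator'_centralizes:
  fixes A :: "('f, 'a) alg"
  assumes E: "cm_variety \<Omega> E" and A: "is_algebra \<Omega> A" "models A E"
    and \<alpha>: "is_congruence \<Omega> A \<alpha>" and u: "\<U> \<in> carrier (Unif \<Omega> A)"
  shows "centralizes \<Omega> A (Ug A \<alpha>) \<U> (commutator' \<Omega> A \<alpha> \<U>)"
  unfolding centralizes_def
proof (intro allI impI ballI)
  let ?C = "commutator' \<Omega> A \<alpha> \<U>"
  fix n n' t W assume t: "nary_term \<Omega> (n + n') t" and W: "W \<in> ?C"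
  have C: "?C \<in> carrier (Unif \<Omega> A)" by (rule commutator'_spec(1)[OF A(1) \<alpha> u])
  then have uC: "is_uniformity (carrier A) ?C" by simp
  have flU: "is_filter_on (carrier A) \<U>" using u by (simp add: is_uniformity_def)
  obtain N and m :: "nat \<Rightarrow> ('f, nat) trm" where
    m: "\<And>i. i \<le> N \<Longrightarrow> wf_trm \<Omega> (m i) \<and> vars (m i) \<subseteq> {..<4}"
    "\<And>\<rho>. range \<rho> \<subseteq> carrier A \<Longrightarrow> eval A \<rho> (m 0) = \<rho> 0"
    "\<And>\<rho>. range \<rho> \<subseteq> carrier A \<Longrightarrow> eval A \<rho> (m N) = \<rho> 3"
    "\<And>i \<rho>. i \<le> N \<Longrightarrow> range \<rho> \<subseteq> carrier A \<Longrightarrow> \<rho> 0 = \<rho> 3 \<Longrightarrow> \<rho> 1 = \<rho> 2 \<Longrightarrow> eval A \<rho> (m i) = \<rho> 0"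
    "\<And>i. i < N \<Longrightarrow>
       (\<forall>\<rho>. range \<rho> \<subseteq> carrier A \<longrightarrow> \<rho> 0 = \<rho> 1 \<longrightarrow> \<rho> 2 = \<rho> 3 \<longrightarrow> eval A \<rho> (m i) = eval A \<rho> (m (Suc i))) \<or>
       (\<forall>\<rho>. range \<rho> \<subseteq> carrier A \<longrightarrow> \<rho> 1 = \<rho> 2 \<longrightarrow> eval A \<rho> (m i) = eval A \<rho> (m (Suc i)))"
    by (rule Day_terms[OF E A]) (rule that)
  have quad_carrier: "range (quad x y z w) \<subseteq> carrier A"
    if "x \<in> carrier A" "y \<in> carrier A" "z \<in> carrier A" "w \<in> carrier A" for x y z w
    using that by (auto simp: quad_def)
  obtain W1 where W1: "W1 \<in> ?C"
    "\<And>g. g 0 \<in> carrier A \<Longrightarrow> \<forall>i<N. (g i, g (Suc i)) \<in> W1 \<Longrightarrow> (g 0, g N) \<in> W"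
    using uniformity_chain[OF uC W, of N] by blast
  obtain W2 where W2: "W2 \<in> ?C" "W2\<inverse> = W2" "W2 O W2 \<subseteq> W1"
    by (rule uniformity_sym_comp[OF uC W1(1)])
  have "\<exists>V\<in>\<U>. \<forall>u11 u12 u21 u22. ((u11, u12), (u21, u22)) \<in> matrices A n n' t \<alpha> V \<longrightarrow>
    (eval A (quad u21 u21 u22 u22) (m i), eval A (quad u21 u11 u12 u22) (m i)) \<in> W2" if "i \<le> N" for i
    by (rule commutator'_quaternary[OF A(1) \<alpha> u t _ _ W2(1)])
      (use m(1)[OF that] m(4)[OF that] quad_carrier in auto)
  then have "\<forall>i\<in>{..N}. \<exists>V. V \<in> \<U> \<and> (\<forall>u11 u12 u21 u22. ((u11, u12), (u21, u22)) \<in> matrices A n n' t \<alpha> V \<longrightarrow>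
    (eval A (quad u21 u21 u22 u22) (m i), eval A (quad u21 u11 u12 u22) (m i)) \<in> W2)" by blast
  from bchoice[OF this] obtain Vf where *: "\<forall>i\<in>{..N}. Vf i \<in> \<U> \<and>
    (\<forall>u11 u12 u21 u22. ((u11, u12), (u21, u22)) \<in> matrices A n n' t \<alpha> (Vf i) \<longrightarrow>
    (eval A (quad u21 u21 u22 u22) (m i), eval A (quad u21 u11 u12 u22) (m i)) \<in> W2)" ..
  then have Vf: "\<And>i. i \<in> {..N} \<Longrightarrow> Vf i \<in> \<U>"
    "\<And>i u11 u12 u21 u22. i \<le> N \<Longrightarrow> ((u11, u12), (u21, u22)) \<in> matrices A n n' t \<alpha> (Vf i) \<Longrightarrow>
    (eval A (quad u21 u21 u22 u22) (m i), eval A (quad u21 u11 u12 u22) (m i)) \<in> W2"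
    by (blast, simp)
  obtain V where V: "V \<in> \<U>" "\<forall>i\<in>{..N}. V \<subseteq> Vf i"
    using filter_finite_Int[OF flU, of "{..N}" Vf] Vf(1) by blast
  have "\<forall>i\<in>{..N}. \<exists>W'. W' \<in> ?C \<and>
    (\<forall>\<rho> \<sigma>. (\<forall>v\<in>vars (m i). (\<rho> v, \<sigma> v) \<in> W') \<longrightarrow> (eval A \<rho> (m i), eval A \<sigma> (m i)) \<in> W2)"
    using compatible_eval[OF A(1) C _ W2(1)] m(1) by (meson atMost_iff)
  from bchoice[OF this] obtain Wf where *: "\<forall>i\<in>{..N}. Wf i \<in> ?C \<and>
    (\<forall>\<rho> \<sigma>. (\<forall>v\<in>vars (m i). (\<rho> v, \<sigma> v) \<in> Wf i) \<longrightarrow> (eval A \<rho> (m i), eval A \<sigma> (m i)) \<in> W2)" ..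
  then have Wf: "\<And>i. i \<in> {..N} \<Longrightarrow> Wf i \<in> ?C"
    "\<And>i \<rho> \<sigma>. i \<le> N \<Longrightarrow> \<forall>v\<in>vars (m i). (\<rho> v, \<sigma> v) \<in> Wf i \<Longrightarrow> (eval A \<rho> (m i), eval A \<sigma> (m i)) \<in> W2"
    by (blast, simp)
  obtain W' where W': "W' \<in> ?C" "\<forall>i\<in>{..N}. W' \<subseteq> Wf i"
    using filter_finite_Int[OF uniformityD(1)[OF uC], of "{..N}" Wf] Wf(1) by blast
  have "(u21, u22) \<in> W"
    if M: "((u11, u12), (u21, u22)) \<in> matrices A n n' t \<alpha> V" and W'u: "(u11, u12) \<in> W'"
    for u11 u12 u21 u22
  proof -
    have "term_op A t xs \<in> carrier A" if "set xs \<subseteq> carrier A" "length xs = n + n'" for xs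
      unfolding term_op_def using t that
      by (intro eval_in_carrier[OF A(1)]) (auto simp: nary_term_def subset_iff)
    then have car: "u11 \<in> carrier A" "u12 \<in> carrier A" "u21 \<in> carrier A" "u22 \<in> carrier A"
      using M unfolding matrices_def by auto
    \<comment> \<open>The chain from \<open>u21\<close> to \<open>u22\<close>, whose ends are given
      by the identities for \<open>m 0\<close> and \<open>m N\<close>.\<close>
    define g where "g i = eval A (quad u21 u11 u12 u22) (m i)" for i
    have reflW: "(x, x) \<in> Wf i" if "i \<le> N" "x \<in> carrier A" for i x
      using uniformityD(2)[OF uC Wf(1)] that by (simp add: refl_on_def)
    have 1: "(eval A (quad u21 u21 u22 u22) (m i), g i) \<in> W2" if "i \<le> N" for i
    proof -
      have "matrices A n n' t \<alpha> V \<subseteq> matrices A n n' t \<alpha> (Vf i)"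
        by (rule matrices_mono) (use V(2) that in auto)
      then show ?thesis unfolding g_def using M by (intro Vf(2) that) blast
    qed
    have 2: "(eval A (quad u21 u11 u11 u22) (m i), g i) \<in> W2" if "i \<le> N" for i
    proof -
      have "(u11, u12) \<in> Wf i" using W'(2) W'u that by auto
      then show ?thesis unfolding g_def
        using reflW[OF that] car by (intro Wf(2) that ballI) (simp add: quad_def)
    qed
    have "(g i, g (Suc i)) \<in> W1" if i: "i < N" for i
    proof -
      \<comment> \<open>The midpoint \<open>h\<close> is the common value of \<open>m i\<close> and
        \<open>m (Suc i)\<close> at a modified assignment where the Day identity applies: y replaced
        by x and z by w in the first case, z replaced by y in the second. The facts \<open>1\<close>
        and \<open>2\<close> put \<open>g i\<close> and \<open>g (Suc i)\<close> close to
        it.\<close>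
      have "\<exists>h. (h, g i) \<in> W2 \<and> (h, g (Suc i)) \<in> W2"
        using m(5)[OF i]
      proof
        assume "\<forall>\<rho>. range \<rho> \<subseteq> carrier A \<longrightarrow> \<rho> 0 = \<rho> 1 \<longrightarrow> \<rho> 2 = \<rho> 3
          \<longrightarrow> eval A \<rho> (m i) = eval A \<rho> (m (Suc i))"
        then have "eval A (quad u21 u21 u22 u22) (m i) = eval A (quad u21 u21 u22 u22) (m (Suc i))"
          using quad_carrier car by simp
        then show ?thesis using 1[of i] 1[of "Suc i"] i by auto
      next
        assume "\<forall>\<rho>. range \<rho> \<subseteq> carrier A \<longrightarrow> \<rho> 1 = \<rho> 2
          \<longrightarrow> eval A \<rho> (m i) = eval A \<rho> (m (Suc i))"
        then have "eval A (quad u21 u11 u11 u22) (m i) = eval A (quad u21 u11 u11 u22) (m (Suc i))"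
          using quad_carrier car by simp
        then show ?thesis using 2[of i] 2[of "Suc i"] i by auto
      qed
      then obtain h where "(h, g i) \<in> W2" "(h, g (Suc i)) \<in> W2" by blast
      moreover from this have "(g i, h) \<in> W2" using W2(2) by blast
      ultimately show ?thesis using W2(3) by blast
    qed
    moreover have "g 0 = u21" "g N = u22"
      using m(2,3)[OF quad_carrier] car by (auto simp: g_def)
    ultimately show ?thesis using W1(2)[of g] car by auto
  qed
  moreover have "\<alpha> \<in> Ug A \<alpha>" using congruenceD(1)[OF \<alpha>] by (simp add: Ug_def)
  ultimately show "\<exists>U\<in>Ug A \<alpha>. \<exists>V\<in>\<U>. \<exists>W'\<in>?C. \<forall>u11 u12 u21 u22.
      ((u11, u12), (u21, u22)) \<in> matrices A n n' t U V \<longrightarrow> (u11, u12) \<in> W' \<longrightarrow> (u21, u22) \<in> W"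
    using V(1) W'(1) by blast
qed

section \<open>Algebras with an underlying group structure\<close>

text \<open>The fixed argument \<open>c\<close> is related to itself by any entourage, so one
  \<open>V\<close> works for all \<open>c\<close>. In the group this says that right translations
  are uniformly equicontinuous.\<close>

lemma compatible_term_op2:
  assumes A: "is_algebra \<Omega> A" and u: "\<U> \<in> carrier (Unif \<Omega> A)" and m: "nary_term \<Omega> 2 m"
    and U: "U \<in> \<U>"
  shows "\<exists>V\<in>\<U>. \<forall>x x' c. (x, x') \<in> V \<longrightarrow> c \<in> carrier A \<longrightarrow> (term_op A m [x, c], term_op A m [x', c]) \<in> U"
proof -
  have wf: "wf_trm \<Omega> m" "vars m \<subseteq> {..<2}" using m by (auto simp: nary_term_def)
  obtain V where V: "V \<in> \<U>"
    "\<And>\<rho> \<sigma>. \<forall>v\<in>vars m. (\<rho> v, \<sigma> v) \<in> V \<Longrightarrow> (eval A \<rho> m, eval A \<sigma> m) \<in> U"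
    using compatible_eval[OF A u wf(1) U] by blast
  have refl: "(c, c) \<in> V" if "c \<in> carrier A" for c
    using u V(1) that by (auto simp: is_uniformity_def refl_on_def)
  show ?thesis
  proof (intro bexI[OF _ V(1)] allI impI)
    fix x x' c assume h: "(x, x') \<in> V" "c \<in> carrier A"
    have "([x, c] ! v, [x', c] ! v) \<in> V" if "v \<in> vars m" for v
    proof -
      have "v = 0 \<or> v = 1" using that wf(2) by auto
      then show ?thesis using h refl by auto
    qed
    then show "(term_op A m [x, c], term_op A m [x', c]) \<in> U"
      unfolding term_op_def by (intro V(2)) blast
  qed
qed

text \<open>By the universal property, a compatible uniformity on A(\<alpha>) whose inverse image
  along the diagonal is contained in \<U> is contained in \<open>Delta_unif\<close>. The proof
  constructs one and then applies the last claim of \<open>commutator'_spec\<close> to its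
  entourages over a common first coordinate.\<close>

lemma group_le_commutator':
  fixes A :: "('f, 'a) alg"
  assumes A: "is_algebra \<Omega> A" and \<alpha>: "is_congruence \<Omega> A \<alpha>" and u: "\<U> \<in> carrier (Unif \<Omega> A)"
    and grp: "has_group_structure \<Omega> A"
    and W: "\<W> \<in> carrier (Unif \<Omega> A)" "centralizes \<Omega> A (Ug A \<alpha>) \<U> \<W>"
  shows "\<W> \<subseteq> commutator' \<Omega> A \<alpha> \<U>"
proof -
  obtain m i e where t: "nary_term \<Omega> 2 m" "nary_term \<Omega> 1 i" and
    G0: "let G = \<lparr>carrier = carrier A, mult = (\<lambda>x y. term_op A m [x, y]), one = term_op A e []\<rparr>
      in group G \<and> (\<forall>x\<in>carrier A. term_op A i [x] = inv\<^bsub>G\<^esub> x)"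
    using grp unfolding has_group_structure_def by blast
  define G where "G = \<lparr>carrier = carrier A, mult = (\<lambda>x y. term_op A m [x, y]), one = term_op A e []\<rparr>"
  have grpG: "group G" and inv: "\<And>x. x \<in> carrier A \<Longrightarrow> term_op A i [x] = inv\<^bsub>G\<^esub> x"
    using G0 by (auto simp: G_def Let_def)
  interpret group G by (rule grpG)
  have carG [simp]: "carrier G = carrier A" by (simp add: G_def)
  have mult: "term_op A m [x, y] = x \<otimes>\<^bsub>G\<^esub> y" for x y by (simp add: G_def)
  have cl [simp]: "x \<otimes>\<^bsub>G\<^esub> y \<in> carrier A" "inv\<^bsub>G\<^esub> x \<in> carrier A"
    if "x \<in> carrier A" "y \<in> carrier A" for x y using that m_closed inv_closed by auto
  have canc: "x \<otimes>\<^bsub>G\<^esub> inv\<^bsub>G\<^esub> y \<otimes>\<^bsub>G\<^esub> y = x" "x \<otimes>\<^bsub>G\<^esub> y \<otimes>\<^bsub>G\<^esub> inv\<^bsub>G\<^esub> y = x"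
    "x \<otimes>\<^bsub>G\<^esub> inv\<^bsub>G\<^esub> x \<otimes>\<^bsub>G\<^esub> y = y"
    if "x \<in> carrier A" "y \<in> carrier A" for x y
    using that by (simp_all add: m_assoc)
  have uU: "is_uniformity (carrier A) \<U>" "is_compatible \<Omega> A \<U>" and
    uW: "is_uniformity (carrier A) \<W>" "is_compatible \<Omega> A \<W>" using u W by auto
  note fU = filterD[OF uniformityD(1)[OF uU(1)]] and fW = filterD[OF uniformityD(1)[OF uW(1)]]
  have rW: "(x, x) \<in> V" if "V \<in> \<W>" "x \<in> carrier A" for V x
    using uniformityD(2)[OF uW(1) that(1)] that(2) by (simp add: refl_on_def)
  have rU: "(x, x) \<in> V" if "V \<in> \<U>" "x \<in> carrier A" for V x
    using uniformityD(2)[OF uU(1) that(1)] that(2) by (simp add: refl_on_def)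
  have transl: "\<exists>V\<in>\<W>. \<forall>x x' c. (x, x') \<in> V \<longrightarrow> c \<in> carrier A \<longrightarrow> (x \<otimes>\<^bsub>G\<^esub> c, x' \<otimes>\<^bsub>G\<^esub> c) \<in> V0"
    if "V0 \<in> \<W>" for V0
    using compatible_term_op2[OF A W(1) t(1) that] by (simp add: mult)
  have \<alpha>A: "x \<in> carrier A" "y \<in> carrier A" if "(x, y) \<in> \<alpha>" for x y
    using congruenceD(1)[OF \<alpha>] that by auto

  let ?B = "con_alg A \<alpha>"
  have B: "is_algebra \<Omega> ?B" by (rule con_alg_algebra[OF \<alpha>])
  \<comment> \<open>The Mal'cev operation of the group: \<open>d y x x = y\<close> and
    \<open>d x x z = z\<close>.\<close>
  define d where "d y x z = y \<otimes>\<^bsub>G\<^esub> inv\<^bsub>G\<^esub> x \<otimes>\<^bsub>G\<^esub> z" for y x z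
  have d: "d y x z \<in> carrier A" if "x \<in> carrier A" "y \<in> carrier A" "z \<in> carrier A" for x y z
    using that by (simp add: d_def)
  define Drel where "Drel V W = {((x, y), (z, w)). (x, y) \<in> \<alpha> \<and> (z, w) \<in> \<alpha> \<and> (x, z) \<in> V \<and> (d y x z, w) \<in> W}"
    for V W
  define \<G> where "\<G> = {Drel V W | V W. V \<in> \<U> \<and> W \<in> \<W>}"
  let ?G = "gen_filter \<alpha> \<G>"
  have sub: "\<G> \<subseteq> Pow (\<alpha> \<times> \<alpha>)" by (auto simp: \<G>_def Drel_def)
  have gen: "Drel V W \<in> ?G" if "V \<in> \<U>" "W \<in> \<W>" for V W
    using gen_filter_superset[OF sub] that by (auto simp: \<G>_def)
  have base: "\<exists>V\<in>\<U>. \<exists>W\<in>\<W>. Drel V W \<subseteq> P" if "P \<in> ?G" for P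
    using that
  proof (induction rule: gen_filter_induct)
    case top
    have "Drel (carrier A \<times> carrier A) (carrier A \<times> carrier A) \<subseteq> \<alpha> \<times> \<alpha>" by (auto simp: Drel_def)
    then show ?case using fU(2) fW(2) by (intro bexI)
  next
    case (base P)
    then show ?case unfolding \<G>_def by blast
  next
    case (inter P Q)
    then obtain V W V' W' where *: "V \<in> \<U>" "W \<in> \<W>" "Drel V W \<subseteq> P" "V' \<in> \<U>" "W' \<in> \<W>" "Drel V' W' \<subseteq> Q"
      by (elim bexE)
    have "Drel (V \<inter> V') (W \<inter> W') \<subseteq> Drel V W \<inter> Drel V' W'" by (auto simp: Drel_def)
    then have "Drel (V \<inter> V') (W \<inter> W') \<subseteq> P \<inter> Q" using *(3,6) by blast
    then show ?case using fU(3)[OF *(1,4)] fW(3)[OF *(2,5)] by (intro bexI)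
  next
    case (mono P Q)
    then show ?case by (elim bexE) (intro bexI, rule order_trans)
  qed

  have "gen_filter (carrier ?B) \<G> \<in> carrier (Unif \<Omega> ?B)"
  proof (rule gen_filter_Unif[OF B]; (unfold con_alg_carrier)?)
    show "\<G> \<subseteq> Pow (\<alpha> \<times> \<alpha>)" by (rule sub)
    fix P assume "P \<in> \<G>"
    then obtain V W where P: "P = Drel V W" and V: "V \<in> \<U>" and W': "W \<in> \<W>" by (auto simp: \<G>_def)
    show "refl_on \<alpha> P"
      unfolding refl_on_def P
    proof clarify
      fix x y assume "(x, y) \<in> \<alpha>"
      moreover have "d y x x = y" using canc \<alpha>A[OF \<open>(x, y) \<in> \<alpha>\<close>] by (simp add: d_def)
      ultimately show "((x, y), (x, y)) \<in> Drel V W"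
        using rU[OF V] rW[OF W'] \<alpha>A[OF \<open>(x, y) \<in> \<alpha>\<close>] by (simp add: Drel_def)
    qed
    obtain W1 where W1: "W1 \<in> \<W>"
      "\<And>x x' c. (x, x') \<in> W1 \<Longrightarrow> c \<in> carrier A \<Longrightarrow> (x \<otimes>\<^bsub>G\<^esub> c, x' \<otimes>\<^bsub>G\<^esub> c) \<in> W\<inverse>"
      using transl[OF uniformityD(3)[OF uW(1) W']] by blast
    \<comment> \<open>Right multiplication by z^-1 x turns y x^-1 z into y, and w into w z^-1 x. So
      the closeness of \<open>d y x z\<close> to \<open>w\<close> becomes closeness of
      \<open>y\<close> to \<open>d w z x\<close>; \<open>W1\<close> is chosen for the converse of
      \<open>W\<close> to match the order of the two sides.\<close>
    have "Drel (V\<inverse>) W1 \<subseteq> P\<inverse>"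
    proof clarify
      fix x y z w assume "((x, y), (z, w)) \<in> Drel (V\<inverse>) W1"
      then have h: "(x, y) \<in> \<alpha>" "(z, w) \<in> \<alpha>" "(z, x) \<in> V" "(d y x z, w) \<in> W1" by (auto simp: Drel_def)
      note c = \<alpha>A[OF h(1)] \<alpha>A[OF h(2)]
      have "(d y x z \<otimes>\<^bsub>G\<^esub> (inv\<^bsub>G\<^esub> z \<otimes>\<^bsub>G\<^esub> x), w \<otimes>\<^bsub>G\<^esub> (inv\<^bsub>G\<^esub> z \<otimes>\<^bsub>G\<^esub> x)) \<in> W\<inverse>"
        by (rule W1(2)[OF h(4)]) (use c in simp)
      moreover have "d y x z \<otimes>\<^bsub>G\<^esub> (inv\<^bsub>G\<^esub> z \<otimes>\<^bsub>G\<^esub> x) = y"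
        using c canc(1)[of y x] canc(2)[of "y \<otimes>\<^bsub>G\<^esub> inv\<^bsub>G\<^esub> x" z]
        by (simp add: d_def m_assoc[symmetric])
      moreover have "w \<otimes>\<^bsub>G\<^esub> (inv\<^bsub>G\<^esub> z \<otimes>\<^bsub>G\<^esub> x) = d w z x" using c by (simp add: d_def m_assoc)
      ultimately show "((z, w), (x, y)) \<in> P" using h by (simp add: P Drel_def)
    qed
    then show "\<exists>Q\<in>?G. Q \<subseteq> P\<inverse>" using gen[OF uniformityD(3)[OF uU(1) V] W1(1)] by blast
    obtain V2 where V2: "V2 \<in> \<U>" "V2 O V2 \<subseteq> V" using uniformityD(4)[OF uU(1) V] by blast
    obtain W2 where W2: "W2 \<in> \<W>" "W2 O W2 \<subseteq> W" using uniformityD(4)[OF uW(1) W'] by blast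
    obtain W3 where W3: "W3 \<in> \<W>"
      "\<And>x x' c. (x, x') \<in> W3 \<Longrightarrow> c \<in> carrier A \<Longrightarrow> (x \<otimes>\<^bsub>G\<^esub> c, x' \<otimes>\<^bsub>G\<^esub> c) \<in> W2"
      using transl[OF W2(1)] by blast
    \<comment> \<open>Right multiplication by z^-1 r turns y x^-1 z into y x^-1 r, and w into w z^-1
      r. This leads from the first pair to the second.\<close>
    have "Drel V2 (W3 \<inter> W2) O Drel V2 (W3 \<inter> W2) \<subseteq> P"
    proof clarify
      fix x y z w r s
      assume "((x, y), (z, w)) \<in> Drel V2 (W3 \<inter> W2)" "((z, w), (r, s)) \<in> Drel V2 (W3 \<inter> W2)"
      then have h: "(x, y) \<in> \<alpha>" "(z, w) \<in> \<alpha>" "(r, s) \<in> \<alpha>" "(x, z) \<in> V2" "(z, r) \<in> V2"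
        "(d y x z, w) \<in> W3" "(d w z r, s) \<in> W2" by (auto simp: Drel_def)
      note c = \<alpha>A[OF h(1)] \<alpha>A[OF h(2)] \<alpha>A[OF h(3)]
      have "(d y x z \<otimes>\<^bsub>G\<^esub> (inv\<^bsub>G\<^esub> z \<otimes>\<^bsub>G\<^esub> r), w \<otimes>\<^bsub>G\<^esub> (inv\<^bsub>G\<^esub> z \<otimes>\<^bsub>G\<^esub> r)) \<in> W2"
        by (rule W3(2)[OF h(6)]) (use c in simp)
      moreover have "d y x z \<otimes>\<^bsub>G\<^esub> (inv\<^bsub>G\<^esub> z \<otimes>\<^bsub>G\<^esub> r) = d y x r"
        using c canc(2)[of "y \<otimes>\<^bsub>G\<^esub> inv\<^bsub>G\<^esub> x" z] by (simp add: d_def m_assoc[symmetric])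
      moreover have "w \<otimes>\<^bsub>G\<^esub> (inv\<^bsub>G\<^esub> z \<otimes>\<^bsub>G\<^esub> r) = d w z r" using c by (simp add: d_def m_assoc)
      ultimately have "(d y x r, s) \<in> W" using h(7) W2(2) by auto
      then show "((x, y), (r, s)) \<in> P" using h V2(2) by (auto simp: P Drel_def)
    qed
    then show "\<exists>Q\<in>?G. Q O Q \<subseteq> P" using gen[OF V2(1) fW(3)[OF W3(1) W2(1)]] by blast
    fix f n assume f: "\<Omega> f = Some n"
    let ?\<omega> = "interp A f"
    have \<omega>: "?\<omega> xs \<in> carrier A" if "length xs = n" "set xs \<subseteq> carrier A" for xs
      using A f that unfolding is_algebra_def by blast
    define dl where "dl ys xs zs = map (\<lambda>j. d (ys ! j) (xs ! j) (zs ! j)) [0..<n]" for ys xs zs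
    have dl: "length (dl ys xs zs) = n" "set (dl ys xs zs) \<subseteq> carrier A"
      if "length xs = n" "set xs \<subseteq> carrier A" "length ys = n" "set ys \<subseteq> carrier A"
        "length zs = n" "set zs \<subseteq> carrier A" for xs ys zs
      using that d by (auto simp: dl_def subset_iff)
    define mt where "mt s t = subst (\<lambda>v. if v = 0 then s else t) m" for s t :: "('f, nat) trm"
    define it where "it s = subst (\<lambda>v. s) i" for s :: "('f, nat) trm"
    have ev_mt: "eval A \<rho> (mt s t) = eval A \<rho> s \<otimes>\<^bsub>G\<^esub> eval A \<rho> t" for \<rho> s t
    proof -
      have "eval A (\<lambda>v. eval A \<rho> (if v = 0 then s else t)) m = eval A (\<lambda>v. [eval A \<rho> s, eval A \<rho> t] ! v) m"
        by (rule eval_cong) (use \<open>nary_term \<Omega> 2 m\<close> in \<open>auto simp: nary_term_def less_Suc_eq numeral_2_eq_2 subset_iff\<close>)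
      then show ?thesis by (simp add: mt_def eval_subst mult[symmetric] term_op_def)
    qed
    have ev_it: "eval A \<rho> (it s) = inv\<^bsub>G\<^esub> eval A \<rho> s" if "eval A \<rho> s \<in> carrier A" for \<rho> s
    proof -
      have "eval A (\<lambda>v. eval A \<rho> s) i = eval A (\<lambda>v. [eval A \<rho> s] ! v) i"
        by (rule eval_cong) (use \<open>nary_term \<Omega> 1 i\<close> in \<open>auto simp: nary_term_def subset_iff\<close>)
      then show ?thesis using inv[OF that] by (simp add: it_def eval_subst term_op_def)
    qed
    have nt_mt: "nary_term \<Omega> k (mt s t)" if "nary_term \<Omega> k s" "nary_term \<Omega> k t" for k s t
      using that \<open>nary_term \<Omega> 2 m\<close> by (auto simp: nary_term_def mt_def vars_subst intro!: wf_subst split: if_splits)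
    have nt_it: "nary_term \<Omega> k (it s)" if "nary_term \<Omega> k s" for k s
      using that \<open>nary_term \<Omega> 1 i\<close> by (auto simp: nary_term_def it_def vars_subst intro!: wf_subst)
    have nt_App: "nary_term \<Omega> k (App f (map g [0..<n]))" if "\<And>j. j < n \<Longrightarrow> nary_term \<Omega> k (g j)" for k g
      using that f by (fastforce simp: nary_term_def list_all_iff)
    \<comment> \<open>With x, y, z in three blocks of \<open>n\<close> variables, this is \<omega>(y
      x^-1 z) \<omega>(z)^-1 \<omega>(x), where \<omega> is the basic operation \<open>f\<close>. It
      equals \<omega>(x) when y = x, for every z, and it equals \<omega>(y) when z = x.\<close>
    define T where "T = mt (mt
        (App f (map (\<lambda>j. mt (mt (Var (n + j)) (it (Var j))) (Var (2 * n + j))) [0..<n]))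
        (it (App f (map (\<lambda>j. Var (2 * n + j)) [0..<n]))))
      (App f (map Var [0..<n]))"
    have T: "nary_term \<Omega> (2 * n + n) T"
      unfolding T_def by (intro nt_mt nt_it nt_App) (auto simp: nary_term_def)
    have evT: "term_op A T ((xs @ ys) @ zs) = ?\<omega> (dl ys xs zs) \<otimes>\<^bsub>G\<^esub> inv\<^bsub>G\<^esub> ?\<omega> zs \<otimes>\<^bsub>G\<^esub> ?\<omega> xs"
      if l: "length xs = n" "set xs \<subseteq> carrier A" "length ys = n" "set ys \<subseteq> carrier A"
        "length zs = n" "set zs \<subseteq> carrier A" for xs ys zs
    proof -
      let ?\<rho> = "\<lambda>v. ((xs @ ys) @ zs) ! v"
      have \<rho>: "?\<rho> j = xs ! j" "?\<rho> (n + j) = ys ! j" "?\<rho> (2 * n + j) = zs ! j" if "j < n" for j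
        using that l by (auto simp: nth_append)
      have ap: "eval A ?\<rho> (App f (map g [0..<n])) = ?\<omega> ts"
        if "length ts = n" "\<And>j. j < n \<Longrightarrow> eval A ?\<rho> (g j) = ts ! j" for g ts
      proof -
        have "map (eval A ?\<rho>) (map g [0..<n]) = ts" using that by (auto intro!: nth_equalityI)
        then show ?thesis by (simp only: eval.simps)
      qed
      have 1: "eval A ?\<rho> (App f (map (\<lambda>j. mt (mt (Var (n + j)) (it (Var j))) (Var (2 * n + j))) [0..<n]))
        = ?\<omega> (dl ys xs zs)"
      proof (rule ap[OF dl(1)[OF l]])
        fix j assume j: "j < n"
        have "eval A ?\<rho> (Var j) \<in> carrier A" using \<rho>(1)[OF j] l j by auto
        then show "eval A ?\<rho> (mt (mt (Var (n + j)) (it (Var j))) (Var (2 * n + j))) = dl ys xs zs ! j"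
          using \<rho>[OF j] j by (simp only: ev_mt ev_it) (simp add: dl_def d_def)
      qed
      have 2: "eval A ?\<rho> (App f (map (\<lambda>j. Var (2 * n + j)) [0..<n])) = ?\<omega> zs"
        by (rule ap) (use l \<rho> in auto)
      have 3: "eval A ?\<rho> (App f (map Var [0..<n])) = ?\<omega> xs"
        by (rule ap) (use l \<rho> in auto)
      have "eval A ?\<rho> (App f (map (\<lambda>j. Var (2 * n + j)) [0..<n])) \<in> carrier A"
        unfolding 2 by (rule \<omega>[OF l(5,6)])
      from ev_it[OF this] have 4: "eval A ?\<rho> (it (App f (map (\<lambda>j. Var (2 * n + j)) [0..<n]))) = inv\<^bsub>G\<^esub> ?\<omega> zs"
        unfolding 2 .
      show ?thesis unfolding term_op_def T_def ev_mt 1 3 4 ..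
    qed
    obtain W4 where W4: "W4 \<in> \<W>"
      "\<And>x x' c. (x, x') \<in> W4 \<Longrightarrow> c \<in> carrier A \<Longrightarrow> (x \<otimes>\<^bsub>G\<^esub> c, x' \<otimes>\<^bsub>G\<^esub> c) \<in> W2"
      using transl[OF W2(1)] by blast
    obtain U V5 W5 where 5: "U \<in> Ug A \<alpha>" "V5 \<in> \<U>" "W5 \<in> \<W>"
      "\<And>u11 u12 u21 u22. ((u11, u12), (u21, u22)) \<in> matrices A (2 * n) n T U V5
        \<Longrightarrow> (u11, u12) \<in> W5 \<Longrightarrow> (u21, u22) \<in> W4"
      using W(2) T W4(1) unfolding centralizes_def by blast
    obtain V6 where V6: "V6 \<in> \<U>" "\<And>xs ys. length xs = n
      \<Longrightarrow> list_all2 (\<lambda>x y. (x, y) \<in> V6) xs ys \<Longrightarrow> (?\<omega> xs, ?\<omega> ys) \<in> V"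
      by (rule compatibleE[OF uU(2) f V]) (rule that)
    obtain W6 where W6: "W6 \<in> \<W>" "\<And>xs ys. length xs = n
      \<Longrightarrow> list_all2 (\<lambda>x y. (x, y) \<in> W6) xs ys \<Longrightarrow> (?\<omega> xs, ?\<omega> ys) \<in> W2"
      by (rule compatibleE[OF uW(2) f W2(1)]) (rule that)
    have "(interp ?B f ps, interp ?B f qs) \<in> P"
      if l: "length ps = n" and pq: "list_all2 (\<lambda>p q. (p, q) \<in> Drel (V5 \<inter> V6) W6) ps qs" for ps qs
    proof -
      define xs ys zs ws where "xs = map fst ps" and "ys = map snd ps" and "zs = map fst qs" and "ws = map snd qs"
      note defs = xs_def ys_def zs_def ws_def
      have lq: "length qs = n" using l pq by (auto dest: list_all2_lengthD)
      then have len: "length xs = n" "length ys = n" "length zs = n" "length ws = n"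
        using l by (auto simp: defs)
      have h: "(xs ! j, ys ! j) \<in> \<alpha> \<and> (zs ! j, ws ! j) \<in> \<alpha> \<and> (xs ! j, zs ! j) \<in> V5 \<and> (xs ! j, zs ! j) \<in> V6
        \<and> (d (ys ! j) (xs ! j) (zs ! j), ws ! j) \<in> W6" if "j < n" for j
      proof -
        have "(ps ! j, qs ! j) \<in> Drel (V5 \<inter> V6) W6" using pq that l by (simp add: list_all2_conv_all_nth)
        then show ?thesis using that l lq by (auto simp: Drel_def defs)
      qed
      have car: "set xs \<subseteq> carrier A" "set ys \<subseteq> carrier A" "set zs \<subseteq> carrier A" "set ws \<subseteq> carrier A"
        using h \<alpha>A len by (fastforce simp: in_set_conv_nth)+
      note \<omega>c = \<omega>[OF len(1) car(1)] \<omega>[OF len(2) car(2)] \<omega>[OF len(3) car(3)] \<omega>[OF len(4) car(4)]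
      have zx: "dl xs xs zs = zs" "dl ys xs xs = ys" "dl xs xs xs = xs"
        using len car canc by (auto simp: dl_def d_def subset_iff intro!: nth_equalityI)
      have int: "interp ?B f ps = (?\<omega> xs, ?\<omega> ys)" "interp ?B f qs = (?\<omega> zs, ?\<omega> ws)"
        by (simp_all add: con_alg_def defs)
      have "ps ! j \<in> \<alpha> \<and> qs ! j \<in> \<alpha>" if "j < n" for j
        using h[OF that] that l lq by (simp add: defs)
      then have "set ps \<subseteq> \<alpha>" "set qs \<subseteq> \<alpha>" by (metis in_set_conv_nth l lq subsetI)+
      then have "interp ?B f ps \<in> \<alpha>" "interp ?B f qs \<in> \<alpha>"
        using B f l lq unfolding is_algebra_def con_alg_carrier by blast+
      then have in\<alpha>: "(?\<omega> xs, ?\<omega> ys) \<in> \<alpha>" "(?\<omega> zs, ?\<omega> ws) \<in> \<alpha>" by (simp_all add: int)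
      have inV: "(?\<omega> xs, ?\<omega> zs) \<in> V"
        by (rule V6(2)) (use len h in \<open>auto simp: list_all2_conv_all_nth\<close>)
      have dc: "?\<omega> (dl ys xs zs) \<in> carrier A"
        by (rule \<omega>) (use dl[of xs ys zs] len car in auto)
      have w1: "(?\<omega> (dl ys xs zs), ?\<omega> ws) \<in> W2"
        by (rule W6(2)) (use len h in \<open>auto simp: list_all2_conv_all_nth dl_def\<close>)
      \<comment> \<open>The rows differ by replacing the second block \<open>xs\<close> by
        \<open>ys\<close>, which is a change along \<alpha>; the columns differ by replacing the
        last block \<open>xs\<close> by \<open>zs\<close>, a change along \<open>V5\<close>. Both
        entries of the first row are \<omega>(x), so they are trivially close and the centralizing
        condition applies to the second row.\<close>
      have "((term_op A T ((xs @ xs) @ xs), term_op A T ((xs @ xs) @ zs)),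
        (term_op A T ((xs @ ys) @ xs), term_op A T ((xs @ ys) @ zs))) \<in> matrices A (2 * n) n T U V5"
      proof -
        have "list_all2 (\<lambda>x y. (x, y) \<in> U) (xs @ xs) (xs @ ys)"
        proof (rule list_all2_appendI)
          have \<alpha>U: "\<alpha> \<subseteq> U" using 5(1) by (simp add: Ug_def)
          show "list_all2 (\<lambda>x y. (x, y) \<in> U) xs xs"
            using \<alpha>U car(1) congruenceD(2)[OF \<alpha>] by (auto simp: list_all2_same)
          show "list_all2 (\<lambda>x y. (x, y) \<in> U) xs ys"
            using \<alpha>U h len by (auto simp: list_all2_conv_all_nth)
        qed
        moreover have "list_all2 (\<lambda>x y. (x, y) \<in> V5) xs zs"
          using h len by (auto simp: list_all2_conv_all_nth)
        moreover have "set (xs @ xs) \<union> set (xs @ ys) \<union> set xs \<union> set zs \<subseteq> carrier A" using car by simp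
        moreover have "length (xs @ xs) = 2 * n" "length (xs @ ys) = 2 * n" using len by auto
        ultimately show ?thesis using len unfolding matrices_def by blast
      qed
      moreover have "term_op A T ((xs @ xs) @ xs) = ?\<omega> xs" "term_op A T ((xs @ xs) @ zs) = ?\<omega> xs"
        "term_op A T ((xs @ ys) @ xs) = ?\<omega> ys"
        "term_op A T ((xs @ ys) @ zs) = ?\<omega> (dl ys xs zs) \<otimes>\<^bsub>G\<^esub> inv\<^bsub>G\<^esub> ?\<omega> zs \<otimes>\<^bsub>G\<^esub> ?\<omega> xs"
        using evT[OF len(1) car(1) len(1) car(1) len(1) car(1)]
          evT[OF len(1) car(1) len(1) car(1) len(3) car(3)]
          evT[OF len(1) car(1) len(2) car(2) len(1) car(1)]
          evT[OF len(1) car(1) len(2) car(2) len(3) car(3)]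
        by (simp_all only: zx canc[OF \<omega>c(1) \<omega>c(1)] canc[OF \<omega>c(2) \<omega>c(1)] canc[OF \<omega>c(3) \<omega>c(1)])
      ultimately have "(?\<omega> ys, ?\<omega> (dl ys xs zs) \<otimes>\<^bsub>G\<^esub> inv\<^bsub>G\<^esub> ?\<omega> zs \<otimes>\<^bsub>G\<^esub> ?\<omega> xs) \<in> W4"
        using 5(4) rW[OF 5(3) \<omega>c(1)] by metis
      \<comment> \<open>Right multiplication by \<omega>(x)^-1 \<omega>(z) removes the correcting
        factors: \<omega>(y) \<omega>(x)^-1 \<omega>(z) is close to \<omega>(y x^-1 z). This says
        that \<omega> nearly commutes with \<open>d\<close>.\<close>
      from W4(2)[OF this, of "inv\<^bsub>G\<^esub> ?\<omega> xs \<otimes>\<^bsub>G\<^esub> ?\<omega> zs"]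
      have "(d (?\<omega> ys) (?\<omega> xs) (?\<omega> zs), ?\<omega> (dl ys xs zs)) \<in> W2"
        using \<omega>c dc canc(1)[of "?\<omega> (dl ys xs zs)" "?\<omega> zs"]
          canc(2)[of "?\<omega> (dl ys xs zs) \<otimes>\<^bsub>G\<^esub> inv\<^bsub>G\<^esub> ?\<omega> zs" "?\<omega> xs"]
        by (simp add: d_def m_assoc[symmetric])
      then have "(d (?\<omega> ys) (?\<omega> xs) (?\<omega> zs), ?\<omega> ws) \<in> W" using w1 W2(2) by blast
      then show ?thesis using in\<alpha> inV by (simp add: P int Drel_def)
    qed
    then show "\<exists>Q\<in>?G. \<forall>ps qs. length ps = n \<longrightarrow> list_all2 (\<lambda>p q. (p, q) \<in> Q) ps qs
        \<longrightarrow> (interp ?B f ps, interp ?B f qs) \<in> P"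
      using gen[OF fU(3)[OF 5(2) V6(1)] W6(1)] by blast
  qed
  then have GU: "?G \<in> carrier (Unif \<Omega> ?B)" by (simp only: con_alg_carrier)
  have "inv_filter A (\<lambda>a. (a, a)) ?G \<subseteq> \<U>"
  proof
    fix P assume "P \<in> inv_filter A (\<lambda>a. (a, a)) ?G"
    then obtain Q where P: "P \<subseteq> carrier A \<times> carrier A" and Q: "Q \<in> ?G" "pull A (\<lambda>a. (a, a)) Q \<subseteq> P"
      unfolding inv_filter_iff[OF gen_filter_filter] by blast
    obtain V W where V: "V \<in> \<U>" "W \<in> \<W>" "Drel V W \<subseteq> Q" using base[OF Q(1)] by blast
    \<comment> \<open>Between diagonal elements, the condition involving \<open>d\<close> reduces to
      reflexivity, and only the closeness of first coordinates remains.\<close>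
    have "V \<subseteq> pull A (\<lambda>a. (a, a)) (Drel V W)"
    proof clarify
      fix b c assume bc: "(b, c) \<in> V"
      then have c: "b \<in> carrier A" "c \<in> carrier A" using fU(1)[OF V(1)] by auto
      then have "d b b c = c" by (simp add: d_def canc)
      then show "(b, c) \<in> pull A (\<lambda>a. (a, a)) (Drel V W)"
        using c bc congruenceD(2)[OF \<alpha>] rW[OF V(2)] by (simp add: pull_def Drel_def)
    qed
    also have "\<dots> \<subseteq> pull A (\<lambda>a. (a, a)) Q" using V(3) by (auto simp: pull_def)
    finally have "V \<subseteq> P" using Q(2) by blast
    then show "P \<in> \<U>" by (rule fU(4)[OF V(1) _ P])
  qed
  then have GD: "?G \<subseteq> Delta_unif \<Omega> A \<alpha> \<U>" by (rule Delta_unif_spec(3)[OF \<alpha> u GU])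
  show ?thesis
  proof (rule commutator'_spec(3)[OF A \<alpha> u W(1)])
    fix W assume "W \<in> \<W>"
    then have "Drel (carrier A \<times> carrier A) W \<in> Delta_unif \<Omega> A \<alpha> \<U>" using gen[OF fU(2)] GD by blast
    \<comment> \<open>Over a common first coordinate \<open>d y x x = y\<close>, so the relation
      states precisely that the second coordinates are \<open>W\<close>-close; the full relation
      serves for the first coordinates.\<close>
    moreover have "(y, z) \<in> W" if "((x, y), (x, z)) \<in> Drel (carrier A \<times> carrier A) W" for x y z
    proof -
      have xy: "(x, y) \<in> \<alpha>" "(d y x x, z) \<in> W" using that by (auto simp: Drel_def)
      then show ?thesis using \<alpha>A[OF xy(1)] by (simp add: d_def canc)
    qed
    ultimately show "\<exists>D\<in>Delta_unif \<Omega> A \<alpha> \<U>. \<forall>x y z. ((x, y), (x, z)) \<in> D \<longrightarrow> (y, z) \<in> W" by blast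
  qed
qed

theorem theorem6p3:
  fixes \<Omega> :: "'f signature" and E :: "(('f, nat) trm \<times> ('f, nat) trm) set"
    and A :: "('f, 'a) alg" and \<alpha> :: "('a \<times> 'a) set" and \<U> :: "('a \<times> 'a) set set"
  assumes "cm_variety \<Omega> E" and "is_algebra \<Omega> A" and "models A E"
    and "\<alpha> \<in> carrier (Con \<Omega> A)" and "\<U> \<in> carrier (Unif \<Omega> A)"
  shows "commutator \<Omega> A (Ug A \<alpha>) \<U> \<sqsubseteq>\<^bsub>Unif \<Omega> A\<^esub> commutator' \<Omega> A \<alpha> \<U> \<and>
    (has_group_structure \<Omega> A \<longrightarrow> commutator \<Omega> A (Ug A \<alpha>) \<U> = commutator' \<Omega> A \<alpha> \<U>)"
proof -
  have \<alpha>: "is_congruence \<Omega> A \<alpha>" using assms(4) by simp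
  note A = assms(2) and \<U> = assms(5)
  have "Ug A \<alpha> \<in> carrier (Unif \<Omega> A)" by (rule Ug_Unif[OF A \<alpha>])
  then have fl: "is_filter_on (carrier A) (Ug A \<alpha>)" "is_filter_on (carrier A) \<U>"
    using \<U> by (auto simp: is_uniformity_def)
  note spec = commutator_spec[OF A fl]
  \<comment> \<open>By the reversed order, this inclusion of filters is the asserted inequality; it
    follows from the leastness of the commutator.\<close>
  have "commutator' \<Omega> A \<alpha> \<U> \<subseteq> commutator \<Omega> A (Ug A \<alpha>) \<U>"
    by (rule spec(3)[OF commutator'_spec(1)[OF A \<alpha> \<U>]
      commutator'_centralizes[OF assms(1) A assms(3) \<alpha> \<U>]])
  moreover have "commutator \<Omega> A (Ug A \<alpha>) \<U> \<subseteq> commutator' \<Omega> A \<alpha> \<U>" if "has_group_structure \<Omega> A"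
    by (rule group_le_commutator'[OF A \<alpha> \<U> that spec(1,2)])
  ultimately show ?thesis by auto
qed

end
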